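(* Let $x:M^2\to\mathbb{R}^3$ be a centroaffine surface given by one of the following two types of surfaces: (i) $x_3=\frac{1}{x_1}+x_1(\ln x_1-\ln x_2)$, with $x_1>0,\ x_2>0$; (ii) $x_2^{1-\alpha}x_3^{1+\alpha}-x_1^2=1$, with $x_1\in\mathbb{R}$, $x_2>0$, $x_3>0$, where $0<\alpha<1$ is a constant. Then $x$ is a hyperbolic centroaffine extremal surface of constant curvature $-1$ (of the centroaffine metric), which is both centroaffine complete and Euclidean complete. Up to a centroaffine transformation, it can be represented as a graph over $\mathbb{R}^2$.
   Context: A centroaffine surface is an immersion $x:M^2\to\mathbb{R}^3$ whose position vector $x$ is everywhere transversal to the tangent plane. In the locally strongly convex case, with $D$ the flat connection of $\mathbb{R}^3$, write $D_Xx_*Z=x_*(\nabla_XZ)-\varepsilon\,h(X,Z)\,x$, where $\varepsilon\in\{1,-1\}$ is chosen so that $h$ is positive definite; $h$ is the centroaffine metric, and the surface is hyperbolic if $\varepsilon=-1$. With $\hat\nabla$ the Levi-Civita connection of $h$, the difference tensor is $K=\nabla-\hat\nabla$ and the Tchebychev vector field is $T=\frac12\operatorname{tr}_hK$. The surface is centroaffine extremal if it satisfies the Euler-Lagrange equation of the area functional of $h$, i.e. $\operatorname{tr}(\hat\nabla T)=0$; for a graph $x_3=f(x_1,x_2)$ this reads $\Delta\ln\Big(\frac{\det(f_{ij})}{(f-\sum_ix_if_i)^{4}}\Big)=0$, $\Delta$ the Laplacian of $h$. Centroaffine completeness is completeness of $h$. Euclidean completeness is completeness of the Riemannian metric induced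 on $M$ from a Euclidean metric on $\mathbb{R}^3$. A centroaffine transformation is an element of $GL(3,\mathbb{R})$ acting on $\mathbb{R}^3$. A surface is a graph over $\mathbb{R}^2$ if it is $\{(y_1,y_2,F(y_1,y_2)):(y_1,y_2)\in\mathbb{R}^2\}$ for a function $F$ defined on all of $\mathbb{R}^2$. *)

theory Defs
  imports "HOL-Analysis.Analysis"
begin

section \<open>Smooth maps on open subsets of the plane\<close>

definition pd :: "2 \<Rightarrow> (real^2 \<Rightarrow> 'b::real_normed_vector) \<Rightarrow> real^2 \<Rightarrow> 'b" where
  "pd i f u = frechet_derivative f (at u) (axis i 1)"

primrec Ck_on :: "nat \<Rightarrow> (real^2 \<Rightarrow> 'b::real_normed_vector) \<Rightarrow> (real^2) set \<Rightarrow> bool" where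
  "Ck_on 0 f U \<longleftrightarrow> continuous_on U f"
| "Ck_on (Suc k) f U \<longleftrightarrow> f differentiable_on U \<and> (\<forall>i. Ck_on k (pd i f) U)"

definition smooth_on :: "(real^2 \<Rightarrow> 'b::real_normed_vector) \<Rightarrow> (real^2) set \<Rightarrow> bool" where
  "smooth_on f U \<longleftrightarrow> (\<forall>k. Ck_on k f U)"

definition pos_def_matrix :: "real^'n^'n \<Rightarrow> bool" where
  "pos_def_matrix A \<longleftrightarrow> transpose A = A \<and> (\<forall>v. v \<noteq> 0 \<longrightarrow> v \<bullet> (A *v v) > 0)"


section \<open>Riemannian geometry in a global chart\<close>

text \<open>A Riemannian metric on an open set \<open>U\<close> of the plane is given by its matrix of components
  \<open>g u $ i $ j\<close>.  A connection is given by its Christoffel symbols: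
  \<open>\<Gamma> k i j u\<close> is the \<open>k\<close>-th component of the derivative of \<open>\<partial>\<^sub>j\<close> in direction \<open>\<partial>\<^sub>i\<close>.\<close>

type_synonym metric = "real^2 \<Rightarrow> real^2^2"
type_synonym symbols = "2 \<Rightarrow> 2 \<Rightarrow> 2 \<Rightarrow> real^2 \<Rightarrow> real"

definition levi_civita :: "metric \<Rightarrow> symbols" where
  "levi_civita g k i j u = (1/2) * (\<Sum>l\<in>UNIV. matrix_inv (g u) $ k $ l *
     (pd i (\<lambda>w. g w $ j $ l) u + pd j (\<lambda>w. g w $ i $ l) u - pd l (\<lambda>w. g w $ i $ j) u))"

text \<open>\<open>riemann \<Gamma> l i j k\<close> is the \<open>l\<close>-th component of
  \<open>R(\<partial>\<^sub>i,\<partial>\<^sub>j)\<partial>\<^sub>k = \<nabla>\<^sub>i\<nabla>\<^sub>j\<partial>\<^sub>k - \<nabla>\<^sub>j\<nabla>\<^sub>i\<partial>\<^sub>k\<close>.\<close>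

definition riemann :: "symbols \<Rightarrow> 2 \<Rightarrow> 2 \<Rightarrow> 2 \<Rightarrow> 2 \<Rightarrow> real^2 \<Rightarrow> real" where
  "riemann \<Gamma> l i j k u = pd i (\<Gamma> l j k) u - pd j (\<Gamma> l i k) u
     + (\<Sum>m\<in>UNIV. \<Gamma> l i m u * \<Gamma> m j k u - \<Gamma> l j m u * \<Gamma> m i k u)"

text \<open>\<open>g(R(\<partial>\<^sub>1,\<partial>\<^sub>2)\<partial>\<^sub>2,\<partial>\<^sub>1)\<close> divided by \<open>det g\<close>\<close>

definition gauss_curvature :: "metric \<Rightarrow> real^2 \<Rightarrow> real" where
  "gauss_curvature g u =
     (\<Sum>l\<in>UNIV. g u $ 1 $ l * riemann (levi_civita g) l 1 2 2 u) / det (g u)"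

text \<open>\<open>tr (Y \<mapsto> \<nabla>\<^sub>Y V)\<close>\<close>

definition divergence :: "symbols \<Rightarrow> (real^2 \<Rightarrow> real^2) \<Rightarrow> real^2 \<Rightarrow> real" where
  "divergence \<Gamma> V u =
     (\<Sum>i\<in>UNIV. pd i (\<lambda>w. V w $ i) u + (\<Sum>j\<in>UNIV. \<Gamma> i i j u * V u $ j))"

definition speed :: "metric \<Rightarrow> (real \<Rightarrow> real^2) \<Rightarrow> real \<Rightarrow> real" where
  "speed g \<gamma> t = sqrt (vector_derivative \<gamma> (at t) \<bullet> (g (\<gamma> t) *v vector_derivative \<gamma> (at t)))"

text \<open>The library's piecewise \<open>C\<^sup>1\<close> paths may have unbounded velocity near a break point, and
  the integral of a non-integrable function is \<open>0\<close> by convention; the integrability condition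
  therefore excludes exactly the paths of infinite length.\<close>

definition admissible_path ::
    "(real^2) set \<Rightarrow> metric \<Rightarrow> real^2 \<Rightarrow> real^2 \<Rightarrow> (real \<Rightarrow> real^2) \<Rightarrow> bool" where
  "admissible_path U g p q \<gamma> \<longleftrightarrow> valid_path \<gamma> \<and> path_image \<gamma> \<subseteq> U \<and> pathstart \<gamma> = p \<and>
     pathfinish \<gamma> = q \<and> speed g \<gamma> integrable_on {0..1}"

text \<open>The infimum is over a non-empty set when \<open>U\<close> is open and connected and \<open>g\<close> is continuous.
  The value \<open>0\<close> off \<open>U\<close> is needed because the locale \<open>Metric_space\<close> asks for non-negativity and
  symmetry on the whole type.\<close>

definition riemannian_dist :: "(real^2) set \<Rightarrow> metric \<Rightarrow> real^2 \<Rightarrow> real^2 \<Rightarrow> real" where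
  "riemannian_dist U g p q = (if p \<in> U \<and> q \<in> U
     then INF \<gamma>\<in>Collect (admissible_path U g p q). integral {0..1} (speed g \<gamma>) else 0)"

definition complete_metric :: "(real^2) set \<Rightarrow> metric \<Rightarrow> bool" where
  "complete_metric U g \<longleftrightarrow> Metric_space U (riemannian_dist U g) \<and>
     Metric_space.mcomplete U (riemannian_dist U g)"


section \<open>Centroaffine surfaces\<close>

definition centroaffine_surface :: "(real^2) set \<Rightarrow> (real^2 \<Rightarrow> real^3) \<Rightarrow> bool" where
  "centroaffine_surface M x \<longleftrightarrow> open M \<and> connected M \<and> M \<noteq> {} \<and> smooth_on x M \<and>
     (\<forall>u\<in>M. inj (frechet_derivative x (at u)) \<and> x u \<notin> range (frechet_derivative x (at u)))"

text \<open>The components \<open>\<Gamma>\<^sup>k\<^sub>i\<^sub>j\<close> and \<open>h\<^sub>i\<^sub>j\<close> in the formula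
  \<open>\<partial>\<^sub>i\<partial>\<^sub>j x = \<Sum>\<^sub>k \<Gamma>\<^sup>k\<^sub>i\<^sub>j \<partial>\<^sub>k x - \<epsilon> h\<^sub>i\<^sub>j x\<close>; they are unique because \<open>\<partial>\<^sub>1 x, \<partial>\<^sub>2 x, x\<close> is a basis.\<close>

definition gauss_formula ::
    "real \<Rightarrow> (real^2 \<Rightarrow> real^3) \<Rightarrow> 2 \<Rightarrow> 2 \<Rightarrow> real^2 \<Rightarrow> (real^2) \<times> real" where
  "gauss_formula \<epsilon> x i j u = (THE (\<Gamma>, h).
     pd i (pd j x) u = (\<Sum>k\<in>UNIV. \<Gamma> $ k *\<^sub>R pd k x u) - (\<epsilon> * h) *\<^sub>R x u)"

definition centroaffine_form :: "real \<Rightarrow> (real^2 \<Rightarrow> real^3) \<Rightarrow> metric" where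
  "centroaffine_form \<epsilon> x u = (\<chi> i j. snd (gauss_formula \<epsilon> x i j u))"

definition convex_with_sign :: "real \<Rightarrow> (real^2) set \<Rightarrow> (real^2 \<Rightarrow> real^3) \<Rightarrow> bool" where
  "convex_with_sign \<epsilon> M x \<longleftrightarrow>
     \<epsilon> \<in> {1, -1} \<and> (\<forall>u\<in>M. pos_def_matrix (centroaffine_form \<epsilon> x u))"

definition locally_strongly_convex :: "(real^2) set \<Rightarrow> (real^2 \<Rightarrow> real^3) \<Rightarrow> bool" where
  "locally_strongly_convex M x \<longleftrightarrow> centroaffine_surface M x \<and> (\<exists>\<epsilon>. convex_with_sign \<epsilon> M x)"

definition centroaffine_sign :: "(real^2) set \<Rightarrow> (real^2 \<Rightarrow> real^3) \<Rightarrow> real" where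
  "centroaffine_sign M x = (THE \<epsilon>. convex_with_sign \<epsilon> M x)"

definition hyperbolic :: "(real^2) set \<Rightarrow> (real^2 \<Rightarrow> real^3) \<Rightarrow> bool" where
  "hyperbolic M x \<longleftrightarrow> locally_strongly_convex M x \<and> centroaffine_sign M x = -1"

definition centroaffine_metric :: "(real^2) set \<Rightarrow> (real^2 \<Rightarrow> real^3) \<Rightarrow> metric" where
  "centroaffine_metric M x = centroaffine_form (centroaffine_sign M x) x"

definition induced_connection :: "(real^2) set \<Rightarrow> (real^2 \<Rightarrow> real^3) \<Rightarrow> symbols" where
  "induced_connection M x k i j u = fst (gauss_formula (centroaffine_sign M x) x i j u) $ k"

definition difference_tensor :: "(real^2) set \<Rightarrow> (real^2 \<Rightarrow> real^3) \<Rightarrow> symbols" where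
  "difference_tensor M x k i j u =
     induced_connection M x k i j u - levi_civita (centroaffine_metric M x) k i j u"

definition tchebychev_field :: "(real^2) set \<Rightarrow> (real^2 \<Rightarrow> real^3) \<Rightarrow> real^2 \<Rightarrow> real^2" where
  "tchebychev_field M x u = (\<chi> k. (1/2) * (\<Sum>i\<in>UNIV. \<Sum>j\<in>UNIV.
     matrix_inv (centroaffine_metric M x u) $ i $ j * difference_tensor M x k i j u))"

definition centroaffine_extremal :: "(real^2) set \<Rightarrow> (real^2 \<Rightarrow> real^3) \<Rightarrow> bool" where
  "centroaffine_extremal M x \<longleftrightarrow> locally_strongly_convex M x \<and>
     (\<forall>u\<in>M. divergence (levi_civita (centroaffine_metric M x)) (tchebychev_field M x) u = 0)"

definition centroaffine_complete :: "(real^2) set \<Rightarrow> (real^2 \<Rightarrow> real^3) \<Rightarrow> bool" where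
  "centroaffine_complete M x \<longleftrightarrow> complete_metric M (centroaffine_metric M x)"

text \<open>A Euclidean metric on \<open>\<real>\<^sup>3\<close> is an arbitrary inner product \<open>\<langle>v, w\<rangle> = v \<bullet> (A *v w)\<close>;
  completeness of the induced metric does not depend on its choice, so all of them are required.\<close>

definition first_fundamental_form :: "real^3^3 \<Rightarrow> (real^2 \<Rightarrow> real^3) \<Rightarrow> metric" where
  "first_fundamental_form A x u = (\<chi> i j. pd i x u \<bullet> (A *v pd j x u))"

definition euclidean_complete :: "(real^2) set \<Rightarrow> (real^2 \<Rightarrow> real^3) \<Rightarrow> bool" where
  "euclidean_complete M x \<longleftrightarrow>
     (\<forall>A. pos_def_matrix A \<longrightarrow> complete_metric M (first_fundamental_form A x))"

definition graph_over_plane :: "(real^3) set \<Rightarrow> bool" where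
  "graph_over_plane S \<longleftrightarrow> (\<exists>F :: real \<Rightarrow> real \<Rightarrow> real. S = {vector [y1, y2, F y1 y2] | y1 y2. True})"


section \<open>The two types of surfaces\<close>

definition surface_i :: "(real^3) set" where
  "surface_i = {p. p $ 1 > 0 \<and> p $ 2 > 0 \<and> p $ 3 = 1 / p $ 1 + p $ 1 * (ln (p $ 1) - ln (p $ 2))}"

definition surface_ii :: "real \<Rightarrow> (real^3) set" where
  "surface_ii \<alpha> = {p. p $ 2 > 0 \<and> p $ 3 > 0 \<and>
     p $ 2 powr (1 - \<alpha>) * p $ 3 powr (1 + \<alpha>) - (p $ 1)^2 = 1}"

text \<open>Both surfaces are graphs over a domain of the \<open>(x\<^sub>1, x\<^sub>2)\<close>-plane, so \<open>x\<^sub>1, x\<^sub>2\<close> are global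
  coordinates.  The following conditions determine \<open>M\<close> and the restriction of \<open>x\<close> to \<open>M\<close>.\<close>

definition in_graph_coordinates ::
    "(real^3) set \<Rightarrow> (real^2) set \<Rightarrow> (real^2 \<Rightarrow> real^3) \<Rightarrow> bool" where
  "in_graph_coordinates S M x \<longleftrightarrow> x ` M = S \<and> (\<forall>u\<in>M. x u $ 1 = u $ 1 \<and> x u $ 2 = u $ 2)"

end

theory Submission
  imports Defs
begin

text \<open>For a graph with height function \<open>f\<close> and \<open>p = f - u\<^sub>1 f\<^sub>1 - u\<^sub>2 f\<^sub>2 > 0\<close> the Gauss formula gives
  \<open>h\<^sub>i\<^sub>j = f\<^sub>i\<^sub>j / p\<close> and \<open>\<Gamma>\<^sup>k\<^sub>i\<^sub>j = - h\<^sub>i\<^sub>j u\<^sub>k\<close>, with \<open>\<epsilon> = -1\<close> as soon as \<open>f\<close> is convex.  Both types of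
  surfaces turn out to have a metric of the same form
  \<open>h = da\<^sup>2 / w + k w (db / b - a da / w)\<^sup>2\<close>, \<open>w = a\<^sup>2 + d\<close>, with \<open>(k, d) = (1/2, 0)\<close> for type (i)
  and \<open>(k, d) = ((1 - \<alpha>) / (1 + \<alpha>), 1)\<close> for type (ii).  This metric has curvature \<open>-1\<close>, and the
  Tchebychev field is the divergence-free field \<open>(0, b (1/k - d) / (2 w))\<close>.

  Completeness of a Riemannian metric follows from the existence of a proper Lipschitz map into
  a Banach space.  For the metric induced from \<open>\<real>\<^sup>3\<close> this map is the immersion itself; for the
  centroaffine metric it is the logarithm of the hyperbolic cosine of a distance in the
  half-plane model (type (i)) or a map built from Fermi coordinates (type (ii)).\<close>

section \<open>Riemannian distance and completeness\<close>

text \<open>Take \<open>s\<close> with ds = da / sqrt w and \<tau> = ln b - (ln w) / 2. The common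
  metric becomes ds^2 + k w d\<tau>^2, and \<phi> = sqrt w satisfies d\<phi>/ds = a and da/ds =
  \<phi> for every \<open>d\<close>. Hence \<phi>'' = \<phi>, which is curvature -1. The Tchebychev
  field is (1/k - d) / (2 w) times the \<tau>-direction, with a coefficient free of \<tau>, so its
  divergence vanishes. Both facts are verified in the coordinates (a, b), where the metric is
  rational.

  The value of \<open>d\<close> decides the completeness argument. For d = 1, a = sinh s and w =
  cosh^2 s is at least 1, so \<tau> is Lipschitz. For d = 0, a = exp s and w = exp (2 s) has infimum
  0; \<tau> is no longer Lipschitz, and a function of the hyperbolic distance takes its place.

  Paths may have unbounded speed near break points, so lengths are estimated by the fundamental
  theorem of calculus with finitely many exceptional points, never by bounds on the
  velocity.\<close>

definition path_lengths :: "(real^2) set \<Rightarrow> metric \<Rightarrow> real^2 \<Rightarrow> real^2 \<Rightarrow> real set" where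
  "path_lengths U g p q = {L. \<exists>\<gamma>. valid_path \<gamma> \<and> path_image \<gamma> \<subseteq> U \<and> pathstart \<gamma> = p \<and>
     pathfinish \<gamma> = q \<and> (speed g \<gamma> has_integral L) {0..1}}"

text \<open>\<open>has_integral\<close> carries integrability and value together, so lengths can be
  reversed and added as elements of a set without meeting the default value of
  \<open>integral\<close>.\<close>

lemma riemannian_dist_eq_Inf:
  assumes "p \<in> U" "q \<in> U"
  shows "riemannian_dist U g p q = Inf (path_lengths U g p q)"
proof -
  have "(\<lambda>\<gamma>. integral {0..1} (speed g \<gamma>)) ` Collect (admissible_path U g p q) = path_lengths U g p q"
    unfolding path_lengths_def admissible_path_def
    by (auto simp: has_integral_iff image_iff)
  then show ?thesis
    using assms by (simp add: riemannian_dist_def)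
qed

lemma speed_eq:
  "(\<gamma> has_vector_derivative d) (at t) \<Longrightarrow> speed g \<gamma> t = sqrt (d \<bullet> (g (\<gamma> t) *v d))"
  by (simp add: speed_def vector_derivative_at)

lemma quadratic_form_scaleR:
  fixes A :: "real^'n^'n"
  shows "(c *\<^sub>R d) \<bullet> (A *v (c *\<^sub>R d)) = c\<^sup>2 * (d \<bullet> (A *v d))"
  by (simp add: matrix_vector_mult_scaleR power2_eq_square)

lemma path_lengths_sym:
  assumes "L \<in> path_lengths U g p q"
  shows "L \<in> path_lengths U g q p"
proof -
  obtain \<gamma> where \<gamma>: "valid_path \<gamma>" "path_image \<gamma> \<subseteq> U" "pathstart \<gamma> = p" "pathfinish \<gamma> = q"
      "(speed g \<gamma> has_integral L) {0..1}"
    using assms by (auto simp: path_lengths_def)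
  obtain S where S: "finite S" "\<And>t. t \<in> {0..1} - S \<Longrightarrow> \<gamma> differentiable (at t)"
    using \<gamma>(1) by (auto simp: valid_path_def piecewise_C1_differentiable_on_def C1_differentiable_on_eq)
  have "((\<lambda>t. speed g \<gamma> (1 - t)) has_integral L) {0..1}"
    using has_integral_affinity01[OF \<gamma>(5), of "-1" 1] by (simp add: algebra_simps)
  \<comment> \<open>Away from the reflected break points the velocity is \<open>- d\<close>, and the
    quadratic form does not see the sign. The finitely many other points are negligible.\<close>
  then have "(speed g (reversepath \<gamma>) has_integral L) {0..1}"
  proof (rule has_integral_spike_finite[where S = "(\<lambda>t. 1 - t) ` S", rotated 2])
    fix t assume t: "t \<in> {0..1} - (\<lambda>t. 1 - t) ` S"
    then have "1 - t \<in> {0..1} - S"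
      by (auto simp: image_iff)
    then obtain d where d: "(\<gamma> has_vector_derivative d) (at (1 - t))"
      using S(2) vector_derivative_works by blast
    have "(\<gamma> \<circ> (\<lambda>t. 1 - t) has_vector_derivative (-1) *\<^sub>R d) (at t)"
      by (rule vector_diff_chain_at) (use d in \<open>auto intro!: derivative_eq_intros\<close>)
    then have "(reversepath \<gamma> has_vector_derivative (-1) *\<^sub>R d) (at t)"
      by (simp add: reversepath_def o_def)
    from speed_eq[OF this, of g] speed_eq[OF d, of g]
    show "speed g (reversepath \<gamma>) t = speed g \<gamma> (1 - t)"
      unfolding quadratic_form_scaleR by (simp add: reversepath_def)
  qed (use S in auto)
  then show ?thesis
    using \<gamma> by (auto simp: path_lengths_def intro!: exI[of _ "reversepath \<gamma>"])
qed

lemma path_lengths_join: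
  assumes "L1 \<in> path_lengths U g p q" "L2 \<in> path_lengths U g q r"
  shows "L1 + L2 \<in> path_lengths U g p r"
proof -
  obtain \<gamma>1 where \<gamma>1: "valid_path \<gamma>1" "path_image \<gamma>1 \<subseteq> U" "pathstart \<gamma>1 = p" "pathfinish \<gamma>1 = q"
      "(speed g \<gamma>1 has_integral L1) {0..1}"
    using assms(1) by (auto simp: path_lengths_def)
  obtain \<gamma>2 where \<gamma>2: "valid_path \<gamma>2" "path_image \<gamma>2 \<subseteq> U" "pathstart \<gamma>2 = q" "pathfinish \<gamma>2 = r"
      "(speed g \<gamma>2 has_integral L2) {0..1}"
    using assms(2) by (auto simp: path_lengths_def)
  obtain S1 where S1: "finite S1" "\<And>t. t \<in> {0..1} - S1 \<Longrightarrow> \<gamma>1 differentiable (at t)"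
    using \<gamma>1(1) by (auto simp: valid_path_def piecewise_C1_differentiable_on_def C1_differentiable_on_eq)
  obtain S2 where S2: "finite S2" "\<And>t. t \<in> {0..1} - S2 \<Longrightarrow> \<gamma>2 differentiable (at t)"
    using \<gamma>2(1) by (auto simp: valid_path_def piecewise_C1_differentiable_on_def C1_differentiable_on_eq)
  have i1: "((\<lambda>t. 2 * speed g \<gamma>1 (2 * t)) has_integral L1) {0..1/2}"
   and i2: "((\<lambda>t. 2 * speed g \<gamma>2 (2 * t - 1)) has_integral L2) {1/2..1}"
    using has_integral_affinity01 [OF \<gamma>1(5), where m= 2 and c=0, THEN has_integral_cmul [where c=2]]
          has_integral_affinity01 [OF \<gamma>2(5), where m= 2 and c="-1", THEN has_integral_cmul [where c=2]]
    by (simp_all only: image_affinity_atLeastAtMost_div_diff, simp_all add: mult_ac)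
  \<comment> \<open>Running twice as fast multiplies the quadratic form by 4 and the speed by 2. The
    joint 1/2 is exceptional because the concatenation may have a corner there.\<close>
  have "(speed g (\<gamma>1 +++ \<gamma>2) has_integral L1) {0..1/2}"
  proof (rule has_integral_spike_finite[OF _ _ i1])
    show "finite (insert (1/2) ((*) 2 -` S1))"
      using S1 by (force intro: finite_vimageI [where h = "(*) (2::real)"] inj_onI)
    fix t assume t: "t \<in> {0..1/2} - insert (1/2) ((*) 2 -` S1)"
    then have "2 * t \<in> {0..1} - S1"
      by auto
    then obtain d where d: "(\<gamma>1 has_vector_derivative d) (at (2 * t))"
      using S1(2) vector_derivative_works by blast
    have "(\<gamma>1 \<circ> (\<lambda>t. 2 * t) has_vector_derivative 2 *\<^sub>R d) (at t)"
      by (rule vector_diff_chain_at) (use d in \<open>auto intro!: derivative_eq_intros\<close>)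
    then have "(\<gamma>1 +++ \<gamma>2 has_vector_derivative 2 *\<^sub>R d) (at t)"
      by (rule has_vector_derivative_transform_within_open[where S = "{..<1/2}"])
         (use t in \<open>auto simp: joinpaths_def\<close>)
    from speed_eq[OF this, of g] speed_eq[OF d, of g] t
    show "speed g (\<gamma>1 +++ \<gamma>2) t = 2 * speed g \<gamma>1 (2 * t)"
      unfolding quadratic_form_scaleR by (simp add: joinpaths_def real_sqrt_mult)
  qed
  moreover have "(speed g (\<gamma>1 +++ \<gamma>2) has_integral L2) {1/2..1}"
  proof (rule has_integral_spike_finite[OF _ _ i2])
    show "finite (insert (1/2) ((\<lambda>t. 2 * t - 1) -` S2))"
      using S2 by (force intro: finite_vimageI [where h = "\<lambda>t. 2 * t - (1::real)"] inj_onI)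
    fix t assume t: "t \<in> {1/2..1} - insert (1/2) ((\<lambda>t. 2 * t - 1) -` S2)"
    then have "2 * t - 1 \<in> {0..1} - S2"
      by auto
    then obtain d where d: "(\<gamma>2 has_vector_derivative d) (at (2 * t - 1))"
      using S2(2) vector_derivative_works by blast
    have "(\<gamma>2 \<circ> (\<lambda>t. 2 * t - 1) has_vector_derivative 2 *\<^sub>R d) (at t)"
      by (rule vector_diff_chain_at) (use d in \<open>auto intro!: derivative_eq_intros\<close>)
    then have "(\<gamma>1 +++ \<gamma>2 has_vector_derivative 2 *\<^sub>R d) (at t)"
      by (rule has_vector_derivative_transform_within_open[where S = "{1/2<..}"])
         (use t in \<open>auto simp: joinpaths_def\<close>)
    from speed_eq[OF this, of g] speed_eq[OF d, of g] t
    show "speed g (\<gamma>1 +++ \<gamma>2) t = 2 * speed g \<gamma>2 (2 * t - 1)"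
      unfolding quadratic_form_scaleR by (simp add: joinpaths_def real_sqrt_mult)
  qed
  ultimately have "(speed g (\<gamma>1 +++ \<gamma>2) has_integral (L1 + L2)) {0..1}"
    by (rule has_integral_combine[rotated 2]) auto
  moreover have "valid_path (\<gamma>1 +++ \<gamma>2)"
    using \<gamma>1 \<gamma>2 by (auto intro: valid_path_join)
  moreover have "path_image (\<gamma>1 +++ \<gamma>2) \<subseteq> U"
    using \<gamma>1 \<gamma>2 path_image_join_subset by fastforce
  ultimately show ?thesis
    using \<gamma>1 \<gamma>2 unfolding path_lengths_def by (auto intro!: exI[of _ "\<gamma>1 +++ \<gamma>2"])
qed

text \<open>The increment of \<open>\<Phi>\<close> along the path is the integral of the velocity of
  \<open>\<Phi> \<circ> \<gamma>\<close>, which is at most \<open>C\<close> times the speed. At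
  break points the fundamental theorem asks only for continuity.\<close>

lemma path_lengths_lower_bound:
  fixes \<Phi> :: "real^2 \<Rightarrow> 'b::banach"
  assumes L: "L \<in> path_lengths U g p q"
    and deriv: "\<And>u. u \<in> U \<Longrightarrow> (\<Phi> has_derivative \<Phi>' u) (at u)"
    and bound: "\<And>u v. u \<in> U \<Longrightarrow> norm (\<Phi>' u v) \<le> C * sqrt (v \<bullet> (g u *v v))"
  shows "dist (\<Phi> p) (\<Phi> q) \<le> C * L"
proof -
  obtain \<gamma> where \<gamma>: "valid_path \<gamma>" "path_image \<gamma> \<subseteq> U" "pathstart \<gamma> = p" "pathfinish \<gamma> = q"
      "(speed g \<gamma> has_integral L) {0..1}"
    using L by (auto simp: path_lengths_def)
  obtain S where S: "finite S" "\<And>t. t \<in> {0..1} - S \<Longrightarrow> \<gamma> differentiable (at t)"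
    using \<gamma>(1) by (auto simp: valid_path_def piecewise_C1_differentiable_on_def C1_differentiable_on_eq)
  define f where "f t = (if t \<in> S then 0 else \<Phi>' (\<gamma> t) (vector_derivative \<gamma> (at t)))" for t
  define s where "s t = (if t \<in> S then 0 else C * speed g \<gamma> t)" for t
  have in_U: "\<gamma> t \<in> U" if "t \<in> {0..1}" for t
    using that \<gamma>(2) by (auto simp: path_image_def)
  have f: "(f has_integral (\<Phi> (\<gamma> 1) - \<Phi> (\<gamma> 0))) {0..1}"
  proof -
    have "((\<lambda>t. f t) has_integral ((\<Phi> \<circ> \<gamma>) 1 - (\<Phi> \<circ> \<gamma>) 0)) {0..1}"
    proof (rule fundamental_theorem_of_calculus_interior_strong[OF S(1)])
      fix t assume t: "t \<in> {0<..<1} - S"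
      then have "(\<gamma> has_vector_derivative vector_derivative \<gamma> (at t)) (at t)"
        using S(2)[of t] vector_derivative_works by auto
      moreover have "(\<Phi> has_derivative \<Phi>' (\<gamma> t)) (at (\<gamma> t))"
        using t by (intro deriv in_U) auto
      ultimately show "((\<Phi> \<circ> \<gamma>) has_vector_derivative f t) (at t)"
        using t vector_derivative_diff_chain_within[of \<gamma> _ t UNIV \<Phi> "\<Phi>' (\<gamma> t)"]
        by (auto simp: f_def intro: has_derivative_at_withinI)
    next
      have "continuous_on U \<Phi>"
        using deriv by (meson continuous_at_imp_continuous_on has_derivative_continuous)
      moreover have "continuous_on {0..1} \<gamma>"
        using \<gamma>(1) by (simp add: valid_path_def piecewise_C1_differentiable_on_def)
      ultimately show "continuous_on {0..1} (\<Phi> \<circ> \<gamma>)"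
        using in_U by (metis continuous_on_compose continuous_on_subset image_subsetI)
    qed simp
    then show ?thesis
      by simp
  qed
  have s: "(s has_integral C * L) {0..1}"
    by (rule has_integral_spike_finite[OF S(1) _ has_integral_mult_right[OF \<gamma>(5)]]) (simp add: s_def)
  have "norm (integral {0..1} f) \<le> integral {0..1} s"
  proof (rule Henstock_Kurzweil_Integration.integral_norm_bound_integral)
    fix t :: real assume t: "t \<in> {0..1}"
    show "norm (f t) \<le> s t"
      using bound[OF in_U[OF t]] by (simp add: f_def s_def speed_def)
  qed (use f s in auto)
  then show ?thesis
    using f s \<gamma>(3,4)
    by (simp add: integral_unique dist_norm norm_minus_commute pathstart_def pathfinish_def)
qed

section \<open>Uniform bounds for quadratic forms, and a differentiable truncation\<close>

lemma compact_quadratic_form_bounds: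
  fixes g :: "'a::topological_space \<Rightarrow> real^'n^'n"
  assumes "compact K" "continuous_on K g" "\<And>u. u \<in> K \<Longrightarrow> pos_def_matrix (g u)"
  obtains l m where "l > 0" "m > 0"
    "\<And>u v. u \<in> K \<Longrightarrow> l * (norm v)\<^sup>2 \<le> v \<bullet> (g u *v v)"
    "\<And>u v. u \<in> K \<Longrightarrow> v \<bullet> (g u *v v) \<le> m * (norm v)\<^sup>2"
proof (cases "K = {}")
  case True
  then show ?thesis
    using that[of 1 1] by auto
next
  case False
  \<comment> \<open>The form is homogeneous of degree 2 in \<open>v\<close>, so its extreme values
    over the unit sphere, attained on the compact set \<open>?S\<close>, give both
    constants.\<close>
  define F :: "'a \<times> (real^'n) \<Rightarrow> real" where "F = (\<lambda>z. snd z \<bullet> (g (fst z) *v snd z))"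
  let ?S = "K \<times> sphere (0::real^'n) 1"
  have g_fst: "continuous_on ?S (\<lambda>z. g (fst z))"
    by (rule continuous_on_compose2[OF assms(2) continuous_on_fst[OF continuous_on_id]]) auto
  have cont: "continuous_on ?S F"
    unfolding F_def matrix_vector_mult_def
    by (intro continuous_intros continuous_on_vec_lambda continuous_on_component g_fst)
  have comp: "compact ?S"
    using assms(1) by (intro compact_Times compact_sphere)
  obtain v :: "real^'n" where "norm v = 1"
    using vector_choose_size[of 1] by auto
  then have ne: "?S \<noteq> {}"
    using False by auto
  obtain z1 where z1: "z1 \<in> ?S" "\<And>z. z \<in> ?S \<Longrightarrow> F z1 \<le> F z"
    using continuous_attains_inf[OF comp ne cont] by blast
  obtain z2 where z2: "z2 \<in> ?S" "\<And>z. z \<in> ?S \<Longrightarrow> F z \<le> F z2"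
    using continuous_attains_sup[OF comp ne cont] by blast
  have pos: "F z > 0" if "z \<in> ?S" for z
  proof -
    have "snd z \<noteq> 0" "fst z \<in> K"
      using that by auto
    then show ?thesis
      using assms(3) unfolding F_def pos_def_matrix_def by blast
  qed
  have eq: "v \<bullet> (g u *v v) = (norm v)\<^sup>2 * F (u, v /\<^sub>R norm v)" if "v \<noteq> 0" for u v
    using that unfolding F_def fst_conv snd_conv quadratic_form_scaleR by (simp add: field_simps)
  show ?thesis
  proof (rule that[of "F z1" "F z2"])
    fix u and v :: "real^'n" assume u: "u \<in> K"
    have *: "(u, v /\<^sub>R norm v) \<in> ?S" if "v \<noteq> 0"
      using that u by simp
    show "F z1 * (norm v)\<^sup>2 \<le> v \<bullet> (g u *v v)"
      by (cases "v = 0") (use z1(2)[OF *] in \<open>auto simp: eq mult.commute\<close>)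
    show "v \<bullet> (g u *v v) \<le> F z2 * (norm v)\<^sup>2"
      by (cases "v = 0") (use z2(2)[OF *] in \<open>auto simp: eq mult.commute\<close>)
  qed (use pos z1 z2 in auto)
qed

lemma pos_def_quadratic_form_nonneg: "pos_def_matrix A \<Longrightarrow> 0 \<le> v \<bullet> (A *v v)"
  by (cases "v = 0") (auto simp: pos_def_matrix_def less_imp_le)

text \<open>Squaring removes the corner of \<open>max 0 s\<close>: at 0 the difference quotient is
  bounded by \<open>\<bar>h\<bar>\<close>.\<close>

lemma has_real_derivative_max_0_power2:
  "((\<lambda>s::real. (max 0 s)\<^sup>2) has_real_derivative 2 * max 0 s) (at s)"
proof (cases "s = 0")
  case True
  have "((\<lambda>h. ((max 0 (0 + h))\<^sup>2 - (max 0 0)\<^sup>2) / h) \<longlongrightarrow> (0::real)) (at 0)"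
  proof (rule Lim_null_comparison)
    show "\<forall>\<^sub>F h in at (0::real). norm (((max 0 (0 + h))\<^sup>2 - (max 0 0)\<^sup>2) / h) \<le> \<bar>h\<bar>"
      by (intro always_eventually allI) (auto simp: max_def power2_eq_square)
  qed (auto intro!: tendsto_eq_intros)
  then show ?thesis
    using True by (simp add: DERIV_def)
next
  case False
  then consider "s > 0" | "s < 0" by linarith
  then show ?thesis
  proof cases
    case 1
    have "((\<lambda>s::real. s\<^sup>2) has_real_derivative 2 * max 0 s) (at s)"
      using 1 by (auto intro!: derivative_eq_intros)
    then show ?thesis
      by (rule has_field_derivative_transform_within_open[where S = "{0<..}"]) (use 1 in auto)
  next
    case 2
    have "((\<lambda>s::real. 0) has_real_derivative 2 * max 0 s) (at s)"
      using 2 by (auto intro!: derivative_eq_intros)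
    then show ?thesis
      by (rule has_field_derivative_transform_within_open[where S = "{..<0}"]) (use 2 in auto)
  qed
qed

lemma continuous_on_quadratic_form:
  fixes g :: "'a::topological_space \<Rightarrow> real^'n^'n" and v :: "'a \<Rightarrow> real^'n"
  assumes "continuous_on S g" "continuous_on S v"
  shows "continuous_on S (\<lambda>t. v t \<bullet> (g t *v v t))"
  unfolding matrix_vector_mult_def
  by (intro continuous_intros continuous_on_vec_lambda continuous_on_component assms)

section \<open>The distance of a continuous Riemannian metric on a plane domain\<close>

locale riemannian_domain =
  fixes U :: "(real^2) set" and g :: metric
  assumes open_U: "open U" and connected_U: "connected U" and continuous_g: "continuous_on U g"
    and pos_def: "\<And>u. u \<in> U \<Longrightarrow> pos_def_matrix (g u)"
begin

abbreviation d where "d \<equiv> riemannian_dist U g"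

lemma path_lengths_nonneg: "L \<in> path_lengths U g p q \<Longrightarrow> 0 \<le> L"
proof -
  assume "L \<in> path_lengths U g p q"
  then obtain \<gamma> where \<gamma>: "\<gamma> ` {0..1} \<subseteq> U" "(speed g \<gamma> has_integral L) {0..1}"
    by (auto simp: path_lengths_def path_image_def)
  have "0 \<le> speed g \<gamma> t" if "t \<in> {0..1}" for t
  proof -
    have "\<gamma> t \<in> U"
      using that \<gamma>(1) by blast
    then show ?thesis
      by (simp add: speed_def pos_def_quadratic_form_nonneg pos_def)
  qed
  then show "0 \<le> L"
    using has_integral_nonneg[OF \<gamma>(2)] by blast
qed

lemma C1_path_lengths:
  assumes "\<gamma> C1_differentiable_on {0..1}" "path_image \<gamma> \<subseteq> U"
  shows "speed g \<gamma> integrable_on {0..1}"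
    and "integral {0..1} (speed g \<gamma>) \<in> path_lengths U g (pathstart \<gamma>) (pathfinish \<gamma>)"
proof -
  have "valid_path \<gamma>"
    using assms(1) by (simp add: valid_path_def C1_differentiable_imp_piecewise)
  moreover show "speed g \<gamma> integrable_on {0..1}"
  proof (rule integrable_continuous_interval)
    have "continuous_on {0..1} \<gamma>"
      using assms(1) by (simp add: C1_differentiable_imp_continuous_on)
    then have "continuous_on {0..1} (\<lambda>t. g (\<gamma> t))"
      using assms(2) continuous_g by (auto intro: continuous_on_compose2 simp: path_image_def)
    moreover have "continuous_on {0..1} (\<lambda>t. vector_derivative \<gamma> (at t))"
      using assms(1) by (simp add: C1_differentiable_on_eq)
    ultimately show "continuous_on {0..1} (speed g \<gamma>)"
      unfolding speed_def by (intro continuous_on_real_sqrt continuous_on_quadratic_form)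
  qed
  ultimately show "integral {0..1} (speed g \<gamma>) \<in> path_lengths U g (pathstart \<gamma>) (pathfinish \<gamma>)"
    using assms(2) by (auto simp: path_lengths_def)
qed

text \<open>Lower bounds on an infimum require a nonempty set. Polynomial paths exist in every
  connected open set and are of class C^1, so their speed is continuous and their length
  finite.\<close>

lemma path_lengths_nonempty:
  assumes "p \<in> U" "q \<in> U"
  shows "path_lengths U g p q \<noteq> {}"
proof -
  obtain \<gamma> where \<gamma>: "polynomial_function \<gamma>" "path_image \<gamma> \<subseteq> U" "pathstart \<gamma> = p" "pathfinish \<gamma> = q"
    using connected_open_polynomial_connected[OF open_U connected_U assms] by blast
  obtain \<gamma>' where \<gamma>': "polynomial_function \<gamma>'" "\<And>t. (\<gamma> has_vector_derivative \<gamma>' t) (at t)"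
    using has_vector_derivative_polynomial_function[OF \<gamma>(1)] by blast
  have "\<gamma> C1_differentiable_on {0..1}"
    unfolding C1_differentiable_on_def
    using \<gamma>' continuous_on_polymonial_function by blast
  then show ?thesis
    using C1_path_lengths(2)[of \<gamma>] \<gamma> by auto
qed

lemma dist_le_path_length: "\<lbrakk>p \<in> U; q \<in> U; L \<in> path_lengths U g p q\<rbrakk> \<Longrightarrow> d p q \<le> L"
  unfolding riemannian_dist_eq_Inf
  by (meson bdd_below.I cInf_lower path_lengths_nonneg)

lemma dist_geI:
  assumes "p \<in> U" "q \<in> U" "\<And>L. L \<in> path_lengths U g p q \<Longrightarrow> c \<le> L"
  shows "c \<le> d p q"
  unfolding riemannian_dist_eq_Inf[OF assms(1,2)]
  using assms path_lengths_nonempty by (intro cInf_greatest) auto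

lemma path_length_near_dist:
  assumes "p \<in> U" "q \<in> U" "e > 0"
  obtains L where "L \<in> path_lengths U g p q" "L < d p q + e"
  using cInf_lessD[OF path_lengths_nonempty[OF assms(1,2)], of "d p q + e"] assms
  by (auto simp: riemannian_dist_eq_Inf)

lemma dist_lower_bound:
  fixes \<Phi> :: "real^2 \<Rightarrow> 'b::banach"
  assumes "p \<in> U" "q \<in> U"
    and deriv: "\<And>u. u \<in> U \<Longrightarrow> (\<Phi> has_derivative \<Phi>' u) (at u)"
    and bound: "\<And>u v. u \<in> U \<Longrightarrow> norm (\<Phi>' u v) \<le> C * sqrt (v \<bullet> (g u *v v))"
    and "C > 0"
  shows "dist (\<Phi> p) (\<Phi> q) \<le> C * d p q"
proof -
  have "dist (\<Phi> p) (\<Phi> q) / C \<le> d p q"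
  proof (rule dist_geI[OF assms(1,2)])
    fix L assume "L \<in> path_lengths U g p q"
    from path_lengths_lower_bound[OF this deriv bound] \<open>C > 0\<close>
    show "dist (\<Phi> p) (\<Phi> q) / C \<le> L"
      by (simp add: field_simps)
  qed
  then show ?thesis
    using \<open>C > 0\<close> by (simp add: field_simps)
qed

text \<open>The distance is separated by the \<open>C\<^sup>1\<close> bump function \<open>max 0 (r\<^sup>2 - |u - p|\<^sup>2)\<^sup>2\<close>, which is
  Lipschitz for \<open>g\<close> because \<open>g\<close> is uniformly definite on its support.\<close>

lemma dist_pos:
  assumes "p \<in> U" "q \<in> U" "p \<noteq> q"
  shows "0 < d p q"
proof -
  obtain r0 where r0: "r0 > 0" "cball p r0 \<subseteq> U"
    using open_U assms(1) open_contains_cball by blast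
  \<comment> \<open>The radius keeps the closed ball inside \<open>U\<close> and leaves
    \<open>q\<close> outside the open ball, where the bump vanishes.\<close>
  define r where "r = min r0 (dist p q)"
  have r: "r > 0" "cball p r \<subseteq> U" "r \<le> norm (q - p)"
    using r0 assms(3) by (auto simp: r_def dist_norm norm_minus_commute)
  obtain l m where l: "l > 0" "\<And>u v. u \<in> cball p r \<Longrightarrow> l * (norm v)\<^sup>2 \<le> v \<bullet> (g u *v v)"
    using compact_quadratic_form_bounds[of "cball p r" g] r(2) pos_def
      continuous_on_subset[OF continuous_g r(2)] by (metis compact_cball subsetD)
  define \<Phi> where "\<Phi> u = (max 0 (r\<^sup>2 - (u - p) \<bullet> (u - p)))\<^sup>2" for u :: "real^2"
  define \<Phi>' where "\<Phi>' u v = - 4 * max 0 (r\<^sup>2 - (u - p) \<bullet> (u - p)) * ((u - p) \<bullet> v)" for u v :: "real^2"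
  have deriv: "(\<Phi> has_derivative \<Phi>' u) (at u)" for u
  proof -
    have "((\<lambda>u. r\<^sup>2 - (u - p) \<bullet> (u - p)) has_derivative (\<lambda>v. - 2 * ((u - p) \<bullet> v))) (at u)"
      by (auto intro!: derivative_eq_intros simp: inner_commute)
    from has_derivative_compose[OF this has_real_derivative_max_0_power2[unfolded has_field_derivative_def]]
    show ?thesis
      unfolding \<Phi>_def \<Phi>'_def by (simp add: mult_ac)
  qed
  \<comment> \<open>On the ball the \<open>max\<close> is at most r^2 and \<open>u - p\<close> has
    norm at most \<open>r\<close>, whence 4 r^3; the division by \<open>sqrt l\<close> passes from
    the Euclidean norm to the length in \<open>g\<close>.\<close>
  define C where "C = 4 * r ^ 3 / sqrt l"
  have bound: "norm (\<Phi>' u v) \<le> C * sqrt (v \<bullet> (g u *v v))" if "u \<in> U" for u v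
  proof (cases "u \<in> cball p r")
    case True
    have nr: "norm (u - p) \<le> r"
      using True by (simp add: dist_norm norm_minus_commute)
    have "norm (\<Phi>' u v) = 4 * max 0 (r\<^sup>2 - (u - p) \<bullet> (u - p)) * \<bar>(u - p) \<bullet> v\<bar>"
      by (simp add: \<Phi>'_def abs_mult)
    also have "\<dots> \<le> 4 * r\<^sup>2 * (r * norm v)"
    proof (intro mult_mono)
      show "\<bar>(u - p) \<bullet> v\<bar> \<le> r * norm v"
        by (rule order_trans[OF Cauchy_Schwarz_ineq2]) (use nr in \<open>simp add: mult_right_mono\<close>)
    qed auto
    also have "\<dots> = C * (sqrt l * norm v)"
      using l(1) by (simp add: C_def power2_eq_square power3_eq_cube)
    also have "\<dots> \<le> C * sqrt (v \<bullet> (g u *v v))"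
    proof (rule mult_left_mono)
      have "sqrt l * norm v = sqrt (l * (norm v)\<^sup>2)"
        by (simp add: real_sqrt_mult)
      then show "sqrt l * norm v \<le> sqrt (v \<bullet> (g u *v v))"
        using l(2)[OF True, of v] by simp
    qed (use r l in \<open>simp add: C_def\<close>)
    finally show ?thesis .
  next
    case False
    then have "r < norm (u - p)"
      by (simp add: dist_norm norm_minus_commute)
    then have "r\<^sup>2 - (u - p) \<bullet> (u - p) \<le> 0"
      using r(1) by (simp add: dot_square_norm)
    then have "\<Phi>' u v = 0"
      by (simp add: \<Phi>'_def)
    moreover have "0 \<le> C * sqrt (v \<bullet> (g u *v v))"
      using r l that pos_def_quadratic_form_nonneg[OF pos_def] by (simp add: C_def)
    ultimately show ?thesis
      by simp
  qed
  have "C > 0"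
    using r l by (simp add: C_def)
  then have "dist (\<Phi> p) (\<Phi> q) \<le> C * d p q"
    using dist_lower_bound[OF assms(1,2) deriv bound] by blast
  moreover have "r\<^sup>2 - (q - p) \<bullet> (q - p) \<le> 0"
    using r by (simp add: dot_square_norm power_mono)
  then have "dist (\<Phi> p) (\<Phi> q) > 0"
    using r(1) by (simp add: \<Phi>_def dist_real_def)
  ultimately show ?thesis
    using \<open>C > 0\<close> by (metis less_le_trans zero_less_mult_pos)
qed

lemma dist_refl: "d p p = 0"
proof (cases "p \<in> U")
  case True
  have "(\<lambda>t. p) C1_differentiable_on {0..1}"
    by simp
  moreover have "speed g (\<lambda>t. p) = (\<lambda>t. 0)"
    by (simp add: fun_eq_iff speed_def)
  ultimately have "0 \<in> path_lengths U g p p"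
    using C1_path_lengths(2)[of "\<lambda>t. p"] True
    by (simp add: path_image_def pathstart_def pathfinish_def image_constant_conv)
  then have "d p p \<le> 0"
    using True dist_le_path_length by blast
  moreover have "0 \<le> d p p"
    using True path_lengths_nonneg by (intro dist_geI) auto
  ultimately show ?thesis
    by simp
qed (simp add: riemannian_dist_def)

lemma dist_sym: "d p q = d q p"
proof -
  have "path_lengths U g p q = path_lengths U g q p"
    using path_lengths_sym by blast
  then show ?thesis
    using riemannian_dist_eq_Inf[of p U q g] riemannian_dist_eq_Inf[of q U p g]
    by (cases "p \<in> U \<and> q \<in> U") (simp, auto simp: riemannian_dist_def)
qed

lemma dist_triangle:
  assumes "p \<in> U" "q \<in> U" "r \<in> U"
  shows "d p r \<le> d p q + d q r"
proof (rule field_le_epsilon)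
  fix e :: real assume "e > 0"
  obtain L1 where L1: "L1 \<in> path_lengths U g p q" "L1 < d p q + e / 2"
    using path_length_near_dist assms \<open>e > 0\<close> by (metis half_gt_zero)
  obtain L2 where L2: "L2 \<in> path_lengths U g q r" "L2 < d q r + e / 2"
    using path_length_near_dist assms \<open>e > 0\<close> by (metis half_gt_zero)
  have "d p r \<le> L1 + L2"
    using path_lengths_join[OF L1(1) L2(1)] assms by (intro dist_le_path_length)
  then show "d p r \<le> d p q + d q r + e"
    using L1 L2 by linarith
qed

sublocale Metric_space U d
proof
  show "0 \<le> d p q" for p q
    using dist_pos[of p q] dist_refl[of p]
    by (cases "p \<in> U \<and> q \<in> U"; cases "p = q") (auto simp: riemannian_dist_def less_imp_le)
  show "d p q = 0 \<longleftrightarrow> p = q" if "p \<in> U" "q \<in> U" for p q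
    using dist_pos[OF that] dist_refl[of p] by (metis less_irrefl)
qed (use dist_sym dist_triangle in blast)+

text \<open>The straight segment to \<open>p\<close> stays in a small ball on which \<open>g\<close>
  is bounded above. This is what turns Euclidean convergence into convergence for
  \<open>d\<close>.\<close>

lemma dist_upper_bound:
  assumes "p \<in> U"
  obtains r C where "r > 0" "cball p r \<subseteq> U" "\<And>q. q \<in> cball p r \<Longrightarrow> d q p \<le> C * dist q p"
proof -
  obtain r where r: "r > 0" "cball p r \<subseteq> U"
    using open_U assms open_contains_cball by blast
  obtain l m where m: "m > 0" "\<And>u v. u \<in> cball p r \<Longrightarrow> v \<bullet> (g u *v v) \<le> m * (norm v)\<^sup>2"
    using compact_quadratic_form_bounds[of "cball p r" g] r(2) pos_def
      continuous_on_subset[OF continuous_g r(2)] by (metis compact_cball subsetD)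
  have "d q p \<le> sqrt m * dist q p" if q: "q \<in> cball p r" for q
  proof -
    let ?\<gamma> = "linepath q p"
    have seg: "path_image ?\<gamma> \<subseteq> cball p r"
      using q r(1) by (auto simp: closed_segment_subset)
    have C1: "?\<gamma> C1_differentiable_on {0..1}"
      unfolding C1_differentiable_on_def
      by (intro exI[of _ "\<lambda>_. p - q"]) (auto intro: has_vector_derivative_linepath_within)
    have L: "integral {0..1} (speed g ?\<gamma>) \<in> path_lengths U g q p"
      using C1_path_lengths(2)[OF C1] seg r(2) by auto
    have "integral {0..1} (speed g ?\<gamma>) \<le> integral {0..1} (\<lambda>t::real. sqrt m * dist q p)"
    proof (rule integral_le)
      show "speed g ?\<gamma> integrable_on {0..1}"
        using C1_path_lengths(1)[OF C1] seg r(2) by auto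
      fix t :: real assume "t \<in> {0..1}"
      then have "?\<gamma> t \<in> cball p r"
        using seg unfolding path_image_def by blast
      from m(2)[OF this, of "p - q"]
      have "sqrt ((p - q) \<bullet> (g (?\<gamma> t) *v (p - q))) \<le> sqrt (m * (norm (p - q))\<^sup>2)"
        by simp
      then show "speed g ?\<gamma> t \<le> sqrt m * dist q p"
        by (simp add: speed_def real_sqrt_mult dist_norm norm_minus_commute)
    qed auto
    moreover have "d q p \<le> integral {0..1} (speed g ?\<gamma>)"
      using L q r(2) assms by (intro dist_le_path_length) auto
    ultimately show ?thesis
      by simp
  qed
  then show ?thesis
    using that r by blast
qed

text \<open>A Hopf--Rinow substitute: a Lipschitz map with relatively compact preimages of bounded sets
  confines every Cauchy sequence to a compact set.\<close>

theorem complete_if_proper_Lipschitz_map: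
  fixes \<Phi> :: "real^2 \<Rightarrow> 'b::banach"
  assumes deriv: "\<And>u. u \<in> U \<Longrightarrow> (\<Phi> has_derivative \<Phi>' u) (at u)"
    and bound: "\<And>u v. u \<in> U \<Longrightarrow> norm (\<Phi>' u v) \<le> C * sqrt (v \<bullet> (g u *v v))" and "C > 0"
    and proper: "\<And>R. \<exists>K. compact K \<and> K \<subseteq> U \<and> {u \<in> U. norm (\<Phi> u) \<le> R} \<subseteq> K"
  shows "complete_metric U g"
proof -
  have "\<exists>a. limitin mtopology \<sigma> a sequentially" if \<sigma>: "MCauchy \<sigma>" for \<sigma>
  proof -
    have in_U: "\<sigma> n \<in> U" for n
      using \<sigma> by (auto simp: MCauchy_def)
    obtain B where B: "\<And>n. d (\<sigma> 0) (\<sigma> n) \<le> B"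
      using MCauchy_imp_mbounded[OF \<sigma>] by (auto simp: mbounded_alt)
    have "norm (\<Phi> (\<sigma> n)) \<le> norm (\<Phi> (\<sigma> 0)) + C * B" for n
    proof -
      have "dist (\<Phi> (\<sigma> 0)) (\<Phi> (\<sigma> n)) \<le> C * d (\<sigma> 0) (\<sigma> n)"
        by (rule dist_lower_bound[OF in_U in_U deriv bound \<open>C > 0\<close>])
      also have "\<dots> \<le> C * B"
        using B \<open>C > 0\<close> by simp
      finally show ?thesis
        using norm_triangle_sub[of "\<Phi> (\<sigma> n)" "\<Phi> (\<sigma> 0)"] by (simp add: dist_norm norm_minus_commute)
    qed
    moreover obtain K where K: "compact K" "K \<subseteq> U"
        "{u \<in> U. norm (\<Phi> u) \<le> norm (\<Phi> (\<sigma> 0)) + C * B} \<subseteq> K"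
      using proper by blast
    ultimately have "\<forall>n. \<sigma> n \<in> K"
      using in_U by blast
    \<comment> \<open>Compactness yields a limit in the Euclidean topology only; the local upper
      bound on \<open>d\<close> carries it over, and a Cauchy sequence with a convergent subsequence
      converges.\<close>
    then obtain a r where a: "a \<in> K" "strict_mono r" "(\<sigma> \<circ> r) \<longlonglongrightarrow> a"
      using K(1) by (meson compact_imp_seq_compact seq_compactE)
    then have "a \<in> U"
      using K by blast
    then obtain e A where e: "e > 0" "\<And>q. q \<in> cball a e \<Longrightarrow> d q a \<le> A * dist q a"
      using dist_upper_bound by metis
    have "limitin mtopology (\<sigma> \<circ> r) a sequentially"
      unfolding limitin_metric_dist_null
    proof (intro conjI)
      have "(\<lambda>n. dist ((\<sigma> \<circ> r) n) a) \<longlonglongrightarrow> 0"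
        using a(3) tendsto_dist_iff by blast
      then have "(\<lambda>n. A * dist ((\<sigma> \<circ> r) n) a) \<longlonglongrightarrow> 0"
        by (rule tendsto_mult_right_zero)
      moreover have "\<forall>\<^sub>F n in sequentially. norm (d ((\<sigma> \<circ> r) n) a) \<le> A * dist ((\<sigma> \<circ> r) n) a"
        using tendstoD[OF a(3) e(1)]
          by eventually_elim (use e(2)[of "\<sigma> (r _)"] in \<open>simp add: dist_commute\<close>)
      ultimately show "(\<lambda>n. d ((\<sigma> \<circ> r) n) a) \<longlonglongrightarrow> 0"
        by (rule Lim_null_comparison[rotated])
    qed (use \<open>a \<in> U\<close> in_U in auto)
    then show ?thesis
      using MCauchy_convergent_subsequence[OF \<sigma> a(2)] by blast
  qed
  then show ?thesis
    unfolding complete_metric_def mcomplete_def using Metric_space_axioms by blast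
qed

end


section \<open>Functions of class \<open>C\<^sup>k\<close> and centroaffine graphs\<close>

lemma pd_eqI: "(f has_derivative f') (at u) \<Longrightarrow> pd i f u = f' (axis i 1)"
  unfolding pd_def by (metis frechet_derivative_at)

lemma has_derivative_cong_open:
  assumes "open U" "u \<in> U" "\<And>w. w \<in> U \<Longrightarrow> f w = g w"
  shows "(f has_derivative D) (at u) \<longleftrightarrow> (g has_derivative D) (at u)"
  using has_derivative_transform_within_open[OF _ assms(1,2), of f D UNIV g]
    has_derivative_transform_within_open[OF _ assms(1,2), of g D UNIV f] assms(3) by auto

lemma pd_cong:
  assumes "open U" "u \<in> U" "\<And>w. w \<in> U \<Longrightarrow> f w = g w"
  shows "pd i f u = pd i g u"
  using has_derivative_cong_open[OF assms] by (simp add: pd_def frechet_derivative_def)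

lemma frechet_derivative_eq_pd:
  assumes "f differentiable (at u)"
  shows "frechet_derivative f (at u) v = v $ 1 *\<^sub>R pd 1 f u + v $ 2 *\<^sub>R pd 2 f u"
proof -
  have lin: "linear (frechet_derivative f (at u))"
    using assms by (rule linear_frechet_derivative)
  have "v = v $ 1 *\<^sub>R axis 1 1 + v $ 2 *\<^sub>R axis 2 1"
    by (simp add: vec_eq_iff forall_2 axis_def)
  then have "frechet_derivative f (at u) v
      = frechet_derivative f (at u) (v $ 1 *\<^sub>R axis 1 1 + v $ 2 *\<^sub>R axis 2 1)"
    by simp
  then show ?thesis
    by (simp add: pd_def linear_add[OF lin] linear_scale[OF lin])
qed

lemma Ck_on_cong:
  assumes "open U" "\<And>u. u \<in> U \<Longrightarrow> f u = g u"
  shows "Ck_on k f U \<longleftrightarrow> Ck_on k g U"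
  using assms(2)
proof (induction k arbitrary: f g)
  case 0
  then show ?case
    using continuous_on_cong[of U U f g] by simp
next
  case (Suc k)
  have "Ck_on k (pd i f) U \<longleftrightarrow> Ck_on k (pd i g) U" for i
    by (rule Suc.IH) (use pd_cong[OF assms(1)] Suc.prems in blast)
  moreover have "f differentiable_on U \<longleftrightarrow> g differentiable_on U"
    using has_derivative_cong_open[OF assms(1) _ Suc.prems]
    by (auto simp: differentiable_on_eq_differentiable_at[OF assms(1)] differentiable_def)
  ultimately show ?case
    by simp
qed

lemma Ck_on_SucD: "Ck_on (Suc k) f U \<Longrightarrow> Ck_on k f U"
  by (induction k arbitrary: f) (auto intro: differentiable_imp_continuous_on)

text \<open>\<open>pd i f\<close> is a total function under control only on \<open>U\<close>. This
  rule lets inductions work with an explicit derivative formula on \<open>U\<close> instead.\<close>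

lemma Ck_on_SucI:
  assumes "open U" "\<And>u. u \<in> U \<Longrightarrow> (f has_derivative f' u) (at u)"
    and "\<And>i. Ck_on k (\<lambda>u. f' u (axis i 1)) U"
  shows "Ck_on (Suc k) f U"
proof -
  have "f differentiable_on U"
    using assms(1,2) by (auto simp: differentiable_on_eq_differentiable_at differentiable_def)
  moreover have "Ck_on k (pd i f) U" for i
    using assms(3)[of i] Ck_on_cong[OF assms(1), of "pd i f" "\<lambda>u. f' u (axis i 1)" k]
      pd_eqI[OF assms(2)] by auto
  ultimately show ?thesis
    by simp
qed

lemma Ck_on_Suc_has_derivative:
  assumes "open U" "Ck_on (Suc k) f U" "u \<in> U"
  shows "(f has_derivative frechet_derivative f (at u)) (at u)"
  using assms by (simp add: differentiable_on_eq_differentiable_at frechet_derivative_works)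

lemma Ck_on_const: "Ck_on k (\<lambda>u. c) U"
proof (induction k arbitrary: c)
  case (Suc k)
  have "pd i (\<lambda>u. c) = (\<lambda>u. 0)" for i
    by (rule ext, subst pd_eqI) (auto intro!: derivative_eq_intros)
  then show ?case
    using Suc by simp
qed simp

lemma Ck_on_vec_nth: "open U \<Longrightarrow> Ck_on k (\<lambda>u. u $ j) U"
proof (induction k)
  case (Suc k)
  show ?case
    by (rule Ck_on_SucI[OF \<open>open U\<close>])
      (auto intro!: bounded_linear_imp_has_derivative bounded_linear_vec_nth Ck_on_const)
qed (simp add: continuous_on_component continuous_on_id)

lemma Ck_on_add:
  assumes "open U" "Ck_on k f U" "Ck_on k g U"
  shows "Ck_on k (\<lambda>u. f u + g u) U"
  using assms(2,3)
proof (induction k arbitrary: f g)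
  case (Suc k)
  show ?case
  proof (rule Ck_on_SucI[OF assms(1)])
    fix u assume "u \<in> U"
    then show "((\<lambda>u. f u + g u) has_derivative
        (\<lambda>v. frechet_derivative f (at u) v + frechet_derivative g (at u) v)) (at u)"
      using Ck_on_Suc_has_derivative[OF assms(1) Suc.prems(1)]
        Ck_on_Suc_has_derivative[OF assms(1) Suc.prems(2)] by (intro derivative_intros)
  next
    fix i
    show "Ck_on k (\<lambda>u. frechet_derivative f (at u) (axis i 1) + frechet_derivative g (at u) (axis i 1)) U"
      using Suc by (simp flip: pd_def)
  qed
qed (auto intro: continuous_intros)

lemma Ck_on_scaleR:
  fixes f :: "real^2 \<Rightarrow> real"
  assumes "open U" "Ck_on k f U" "Ck_on k g U"
  shows "Ck_on k (\<lambda>u. f u *\<^sub>R g u) U"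
  using assms(2,3)
proof (induction k arbitrary: f g)
  case (Suc k)
  show ?case
  proof (rule Ck_on_SucI[OF assms(1)])
    fix u assume "u \<in> U"
    then show "((\<lambda>u. f u *\<^sub>R g u) has_derivative
        (\<lambda>v. f u *\<^sub>R frechet_derivative g (at u) v + frechet_derivative f (at u) v *\<^sub>R g u)) (at u)"
      using Ck_on_Suc_has_derivative[OF assms(1) Suc.prems(1)]
        Ck_on_Suc_has_derivative[OF assms(1) Suc.prems(2)] by (intro derivative_intros)
  next
    fix i
    have "Ck_on k f U" "Ck_on k g U"
      using Suc.prems Ck_on_SucD by blast+
    then show "Ck_on k (\<lambda>u. f u *\<^sub>R frechet_derivative g (at u) (axis i 1)
        + frechet_derivative f (at u) (axis i 1) *\<^sub>R g u) U"
      using Suc by (auto intro!: Ck_on_add assms(1) simp flip: pd_def)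
  qed
qed (auto intro: continuous_intros)

lemmas Ck_on_mult = Ck_on_scaleR[where ?'a = real, unfolded real_scaleR_def]

text \<open>Differentiation lowers the exponent by one, so the induction runs over all exponents at
  once. Reciprocals are the case of exponent -1.\<close>

lemma Ck_on_powr:
  fixes f :: "real^2 \<Rightarrow> real"
  assumes "open U" "Ck_on k f U" "\<And>u. u \<in> U \<Longrightarrow> 0 < f u"
  shows "Ck_on k (\<lambda>u. f u powr r) U"
  using assms(2)
proof (induction k arbitrary: r)
  case 0
  then show ?case
    using assms(3) by (fastforce intro!: continuous_intros)
next
  case (Suc k)
  show ?case
  proof (rule Ck_on_SucI[OF assms(1)])
    fix u assume u: "u \<in> U"
    have "((\<lambda>t. t powr r) has_real_derivative r * f u powr (r - 1)) (at (f u))"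
      using assms(3)[OF u] by (rule has_real_derivative_powr)
    from has_derivative_compose[OF Ck_on_Suc_has_derivative[OF assms(1) Suc.prems u]
        this[unfolded has_field_derivative_def]]
    show "((\<lambda>u. f u powr r) has_derivative
        (\<lambda>v. r * f u powr (r - 1) * frechet_derivative f (at u) v)) (at u)" .
  next
    fix i
    show "Ck_on k (\<lambda>u. r * f u powr (r - 1) * frechet_derivative f (at u) (axis i 1)) U"
      using Suc.prems Suc.IH[OF Ck_on_SucD[OF Suc.prems]]
      by (auto intro!: Ck_on_mult Ck_on_const assms(1) simp flip: pd_def)
  qed
qed

text \<open>One differentiation turns the logarithm into a power with exponent -1, so a case
  distinction replaces the induction.\<close>

lemma Ck_on_ln:
  fixes f :: "real^2 \<Rightarrow> real"
  assumes "open U" "Ck_on k f U" "\<And>u. u \<in> U \<Longrightarrow> 0 < f u"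
  shows "Ck_on k (\<lambda>u. ln (f u)) U"
proof (cases k)
  case 0
  then show ?thesis
    using assms(2,3) by (fastforce intro!: continuous_intros)
next
  case (Suc k')
  have Ck: "Ck_on (Suc k') f U"
    using assms(2) Suc by simp
  show ?thesis
    unfolding Suc
  proof (rule Ck_on_SucI[OF assms(1)])
    fix u assume u: "u \<in> U"
    have "(ln has_real_derivative f u powr (-1)) (at (f u))"
      using assms(3)[OF u] by (auto intro!: derivative_eq_intros simp: powr_minus_divide)
    from has_derivative_compose[OF Ck_on_Suc_has_derivative[OF assms(1) Ck u]
        this[unfolded has_field_derivative_def]]
    show "((\<lambda>u. ln (f u)) has_derivative
        (\<lambda>v. f u powr (-1) * frechet_derivative f (at u) v)) (at u)" .
  next
    fix i
    show "Ck_on k' (\<lambda>u. f u powr (-1) * frechet_derivative f (at u) (axis i 1)) U"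
      using Ck Ck_on_SucD[OF Ck] unfolding pd_def[symmetric]
      by (intro Ck_on_mult Ck_on_powr assms(1,3)) auto
  qed
qed

section \<open>Definite forms in two variables and the metric induced from space\<close>

lemma quadratic_form_2:
  fixes A :: "real^2^2"
  shows "v \<bullet> (A *v v) = A $ 1 $ 1 * (v $ 1)\<^sup>2 + (A $ 1 $ 2 + A $ 2 $ 1) * (v $ 1 * v $ 2)
    + A $ 2 $ 2 * (v $ 2)\<^sup>2"
  by (simp add: matrix_vector_mult_def inner_vec_def sum_2 power2_eq_square algebra_simps)

text \<open>Completing the square: multiplied by its first diagonal entry, the form is a square plus
  the determinant times the square of \<open>v $ 2\<close>.\<close>

lemma pos_def_matrix_2:
  fixes A :: "real^2^2"
  assumes "A $ 2 $ 1 = A $ 1 $ 2" "A $ 1 $ 1 > 0" "A $ 1 $ 1 * A $ 2 $ 2 - (A $ 1 $ 2)\<^sup>2 > 0"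
  shows "pos_def_matrix A"
  unfolding pos_def_matrix_def
proof (intro conjI allI impI)
  show "transpose A = A"
    using assms(1) by (simp add: transpose_def vec_eq_iff forall_2)
  fix v :: "real^2" assume v: "v \<noteq> 0"
  have eq: "A $ 1 $ 1 * (v \<bullet> (A *v v)) = (A $ 1 $ 1 * v $ 1 + A $ 1 $ 2 * v $ 2)\<^sup>2
      + (A $ 1 $ 1 * A $ 2 $ 2 - (A $ 1 $ 2)\<^sup>2) * (v $ 2)\<^sup>2"
    unfolding quadratic_form_2 assms(1) by (simp add: power2_eq_square algebra_simps)
  have "\<dots> > 0"
  proof (cases "v $ 2 = 0")
    case True
    then have "v $ 1 \<noteq> 0"
      using v by (simp add: vec_eq_iff forall_2)
    then show ?thesis
      using True assms(2) by simp
  next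
    case False
    then show ?thesis
      using assms(3) by (intro add_nonneg_pos) auto
  qed
  then show "0 < v \<bullet> (A *v v)"
    using assms(2) eq by (metis zero_less_mult_pos)
qed

lemma smooth_on_continuous_pd: "smooth_on x M \<Longrightarrow> continuous_on M (pd i x)"
  unfolding smooth_on_def by (metis Ck_on.simps)

lemma smooth_on_differentiable: "\<lbrakk>open M; smooth_on x M; u \<in> M\<rbrakk> \<Longrightarrow> x differentiable (at u)"
  unfolding smooth_on_def by (metis Ck_on.simps(2) differentiable_on_eq_differentiable_at)

lemma first_fundamental_form_quadratic_form:
  assumes "x differentiable (at u)" "pos_def_matrix A"
  shows "v \<bullet> (first_fundamental_form A x u *v v)
    = frechet_derivative x (at u) v \<bullet> (A *v frechet_derivative x (at u) v)"
proof -
  have "a \<bullet> (A *v b) = b \<bullet> (A *v a)" for a b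
    using assms(2) unfolding pos_def_matrix_def
    by (metis dot_lmul_matrix inner_commute transpose_matrix_vector)
  then show ?thesis
    unfolding quadratic_form_2 frechet_derivative_eq_pd[OF assms(1)]
    by (simp add: first_fundamental_form_def inner_add_left inner_add_right matrix_vector_right_distrib
        matrix_vector_mult_scaleR power2_eq_square algebra_simps)
qed

text \<open>The immersion is its own proper Lipschitz map: the induced length of \<open>v\<close> is
  the \<open>A\<close>-length of its image, and definiteness of \<open>A\<close> compares this with
  the standard norm.\<close>

theorem euclidean_complete_if_proper:
  assumes x: "centroaffine_surface M x"
    and proper: "\<And>R. \<exists>K. compact K \<and> K \<subseteq> M \<and> {u \<in> M. norm (x u) \<le> R} \<subseteq> K"
  shows "euclidean_complete M x"
  unfolding euclidean_complete_def
proof (intro allI impI)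
  fix A :: "real^3^3" assume A: "pos_def_matrix A"
  let ?g = "first_fundamental_form A x"
  have M: "open M" "connected M" "smooth_on x M"
    using x by (auto simp: centroaffine_surface_def)
  have diff: "x differentiable (at u)" if "u \<in> M" for u
    using smooth_on_differentiable M that by blast
  have inj: "frechet_derivative x (at u) v \<noteq> 0" if "u \<in> M" "v \<noteq> 0" for u v
  proof -
    have "inj (frechet_derivative x (at u))"
      using x that(1) by (simp add: centroaffine_surface_def)
    moreover have "linear (frechet_derivative x (at u))"
      using diff that(1) linear_frechet_derivative by blast
    ultimately show ?thesis
      using that(2) by (metis linear_injective_0)
  qed
  interpret riemannian_domain M ?g
  proof
    show "continuous_on M ?g"
      unfolding first_fundamental_form_def matrix_vector_mult_def
      by (intro continuous_intros continuous_on_vec_lambda continuous_on_component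
          smooth_on_continuous_pd M(3))
    fix u assume u: "u \<in> M"
    have "pd i x u \<bullet> (A *v pd j x u) = pd j x u \<bullet> (A *v pd i x u)" for i j
      using A unfolding pos_def_matrix_def
      by (metis dot_lmul_matrix inner_commute transpose_matrix_vector)
    then show "pos_def_matrix (?g u)"
      using A inj[OF u] unfolding pos_def_matrix_def[of "?g u"]
        first_fundamental_form_quadratic_form[OF diff[OF u] A]
      by (auto simp: pos_def_matrix_def transpose_def first_fundamental_form_def vec_eq_iff)
  qed (use M in auto)
  \<comment> \<open>A constant family over a one-point space gives the bound for the single matrix
    \<open>A\<close>.\<close>
  obtain l m where l: "l > 0" "\<And>v. l * (norm v)\<^sup>2 \<le> v \<bullet> (A *v v)"
    using compact_quadratic_form_bounds[of "{0::real}" "\<lambda>_. A"] A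
    by (metis compact_sing continuous_on_const singletonI)
  show "complete_metric M ?g"
  proof (rule complete_if_proper_Lipschitz_map[where \<Phi> = x and C = "1 / sqrt l"])
    fix u assume u: "u \<in> M"
    then show "(x has_derivative frechet_derivative x (at u)) (at u)"
      using diff by (simp add: frechet_derivative_works)
    fix v
    let ?w = "frechet_derivative x (at u) v"
    have "sqrt l * norm ?w = sqrt (l * (norm ?w)\<^sup>2)"
      by (simp add: real_sqrt_mult)
    also have "\<dots> \<le> sqrt (v \<bullet> (?g u *v v))"
      using l(2) by (simp add: first_fundamental_form_quadratic_form[OF diff[OF u] A])
    finally show "norm ?w \<le> 1 / sqrt l * sqrt (v \<bullet> (?g u *v v))"
      using l(1) by (simp add: field_simps)
  qed (use l proper in auto)
qed

section \<open>The Gauss formula of a graph\<close>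

lemma vector_3_axis: "(vector [a, b, c] :: real^3) = a *\<^sub>R axis 1 1 + b *\<^sub>R axis 2 1 + c *\<^sub>R axis 3 1"
  by (simp add: vec_eq_iff forall_3 axis_def)

abbreviation has_partials :: "(real^2 \<Rightarrow> real) \<Rightarrow> real \<Rightarrow> real \<Rightarrow> real^2 \<Rightarrow> bool" where
  "has_partials f a b u \<equiv> (f has_derivative (\<lambda>v. a * v $ 1 + b * v $ 2)) (at u)"

lemma has_partials_pd:
  assumes "has_partials f a b u"
  shows "pd 1 f u = a" "pd 2 f u = b"
  using pd_eqI[OF assms, of 1] pd_eqI[OF assms, of 2] by (simp_all add: axis_def)

text \<open>The Hessian of \<open>f\<close> is supplied as \<open>p\<close> times the metric, so no
  division by \<open>p\<close> has to be carried along. \<open>p\<close> is the vertical coefficient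
  of the position vector when it is split into a tangential and a vertical part;
  \<open>p > 0\<close> gives transversality.\<close>

locale graph_surface =
  fixes M :: "(real^2) set" and x :: "real^2 \<Rightarrow> real^3" and f f1 f2 p h11 h12 h22 :: "real^2 \<Rightarrow> real"
  assumes open_M: "open M" and connected_M: "connected M" and nonempty_M: "M \<noteq> {}"
    and x_eq: "\<And>u. u \<in> M \<Longrightarrow> x u = vector [u $ 1, u $ 2, f u]"
    and f_smooth: "smooth_on f M"
    and f_partials: "\<And>u. u \<in> M \<Longrightarrow> has_partials f (f1 u) (f2 u) u"
    and f1_partials: "\<And>u. u \<in> M \<Longrightarrow> has_partials f1 (p u * h11 u) (p u * h12 u) u"
    and f2_partials: "\<And>u. u \<in> M \<Longrightarrow> has_partials f2 (p u * h12 u) (p u * h22 u) u"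
    and p_eq: "\<And>u. u \<in> M \<Longrightarrow> p u = f u - u $ 1 * f1 u - u $ 2 * f2 u"
    and p_pos: "\<And>u. u \<in> M \<Longrightarrow> p u > 0"
    and h11_pos: "\<And>u. u \<in> M \<Longrightarrow> h11 u > 0"
    and h_det_pos: "\<And>u. u \<in> M \<Longrightarrow> h11 u * h22 u - (h12 u)\<^sup>2 > 0"
begin

definition H :: metric where
  "H u = vector [vector [h11 u, h12 u], vector [h12 u, h22 u]]"

lemma H_simps [simp]:
  "H u $ 1 $ 1 = h11 u" "H u $ 1 $ 2 = h12 u" "H u $ 2 $ 1 = h12 u" "H u $ 2 $ 2 = h22 u"
  by (simp_all add: H_def)

lemma pos_def_H: "u \<in> M \<Longrightarrow> pos_def_matrix (H u)"
  using h11_pos h_det_pos by (intro pos_def_matrix_2) auto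

lemma x_has_derivative:
  assumes "u \<in> M"
  shows "(x has_derivative (\<lambda>v. vector [v $ 1, v $ 2, f1 u * v $ 1 + f2 u * v $ 2])) (at u)"
proof -
  have "((\<lambda>u. u $ 1 *\<^sub>R axis 1 1 + u $ 2 *\<^sub>R axis 2 1 + f u *\<^sub>R axis 3 1) has_derivative
      (\<lambda>v. v $ 1 *\<^sub>R axis 1 1 + v $ 2 *\<^sub>R axis 2 1 + (f1 u * v $ 1 + f2 u * v $ 2) *\<^sub>R axis 3 (1::real))) (at u)"
    by (intro has_derivative_add has_derivative_scaleR_left f_partials[OF assms]
        bounded_linear_imp_has_derivative bounded_linear_vec_nth)
  then show ?thesis
    unfolding vector_3_axis
    by (rule has_derivative_transform_within_open[OF _ open_M assms]) (simp add: x_eq vector_3_axis)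
qed

lemma x_smooth: "smooth_on x M"
  unfolding smooth_on_def
proof
  fix k
  have "Ck_on k (\<lambda>u. u $ 1 *\<^sub>R axis 1 1 + u $ 2 *\<^sub>R axis 2 1 + f u *\<^sub>R axis 3 (1::real)) M"
    using f_smooth
    by (intro Ck_on_add Ck_on_scaleR Ck_on_vec_nth Ck_on_const open_M) (auto simp: smooth_on_def)
  then show "Ck_on k x M"
    using Ck_on_cong[OF open_M, of x _ k] by (simp add: x_eq vector_3_axis)
qed

lemma frechet_derivative_x:
  "u \<in> M \<Longrightarrow> frechet_derivative x (at u) = (\<lambda>v. vector [v $ 1, v $ 2, f1 u * v $ 1 + f2 u * v $ 2])"
  by (rule frechet_derivative_at[OF x_has_derivative, symmetric])

lemma centroaffine_surface: "centroaffine_surface M x"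
  unfolding centroaffine_surface_def
proof (intro conjI ballI)
  fix u assume u: "u \<in> M"
  show "inj (frechet_derivative x (at u))"
  proof (rule injI)
    fix v w assume "frechet_derivative x (at u) v = frechet_derivative x (at u) w"
    then have "(vector [v $ 1, v $ 2, f1 u * v $ 1 + f2 u * v $ 2] :: real^3)
        = vector [w $ 1, w $ 2, f1 u * w $ 1 + f2 u * w $ 2]"
      unfolding frechet_derivative_x[OF u] .
    then have "v $ 1 = w $ 1" "v $ 2 = w $ 2"
      by (metis vector_3)+
    then show "v = w"
      by (simp add: vec_eq_iff forall_2)
  qed
  show "x u \<notin> range (frechet_derivative x (at u))"
  proof
    assume "x u \<in> range (frechet_derivative x (at u))"
    then have "f u = f1 u * u $ 1 + f2 u * u $ 2"
      unfolding frechet_derivative_x[OF u] using x_eq[OF u] by (auto simp: vec_eq_iff forall_3)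
    then show False
      using p_eq[OF u] p_pos[OF u] by (simp add: algebra_simps)
  qed
qed (use open_M connected_M nonempty_M x_smooth in auto)

lemma pd_x:
  assumes "u \<in> M"
  shows "pd 1 x u = vector [1, 0, f1 u]" "pd 2 x u = vector [0, 1, f2 u]"
  using pd_eqI[OF x_has_derivative[OF assms], of 1] pd_eqI[OF x_has_derivative[OF assms], of 2]
  by (simp_all add: axis_def)

lemma pd_vector_3:
  assumes "u \<in> M" "\<And>w. w \<in> M \<Longrightarrow> y w = vector [a, b, g w]" "has_partials g g1 g2 u"
  shows "pd 1 y u = vector [0, 0, g1]" "pd 2 y u = (vector [0, 0, g2] :: real^3)"
proof -
  have "((\<lambda>w. a *\<^sub>R axis 1 1 + b *\<^sub>R axis 2 1 + g w *\<^sub>R axis 3 1 :: real^3) has_derivative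
      (\<lambda>v. 0 + (g1 * v $ 1 + g2 * v $ 2) *\<^sub>R axis 3 (1::real))) (at u)"
    by (intro has_derivative_add has_derivative_scaleR_left has_derivative_const assms(3))
  then have "(y has_derivative (\<lambda>v. vector [0, 0, g1 * v $ 1 + g2 * v $ 2])) (at u)"
    using has_derivative_cong_open[OF open_M assms(1), of y "\<lambda>w. vector [a, b, g w]"] assms(2)
    by (simp add: vector_3_axis)
  from pd_eqI[OF this, of 1] pd_eqI[OF this, of 2]
  show "pd 1 y u = vector [0, 0, g1]" "pd 2 y u = (vector [0, 0, g2] :: real^3)"
    by (simp_all add: axis_def)
qed

lemma pd_pd_x:
  assumes "u \<in> M"
  shows "pd i (pd j x) u = vector [0, 0, p u * H u $ i $ j]"
proof -
  note * = pd_vector_3[OF assms pd_x(1) f1_partials[OF assms]]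
    pd_vector_3[OF assms pd_x(2) f2_partials[OF assms]]
  show ?thesis
    using exhaust_2[of i] exhaust_2[of j] by (auto simp: *)
qed

text \<open>Write x = u_1 x_1 + u_2 x_2 + p e_3. The second derivatives of \<open>x\<close> are p
  H_ij e_3 = H_ij (x - u_1 x_1 - u_2 x_2), and both components are read off. Both signs
  \<open>e\<close> are allowed because the right one is determined only afterwards.\<close>

lemma gauss_formula_eq:
  assumes u: "u \<in> M" and e: "e = 1 \<or> e = - 1"
  shows "gauss_formula e x i j u = (\<chi> k. - H u $ i $ j * u $ k, - e * H u $ i $ j)"
proof -
  have "vector [0, 0, p u * H u $ i $ j] = (\<Sum>k\<in>UNIV. G $ k *\<^sub>R pd k x u) - (e * h) *\<^sub>R x u \<longleftrightarrow>
     (G, h) = (\<chi> k. - H u $ i $ j * u $ k, - e * H u $ i $ j)" for G h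
  proof -
    have ee: "e * e = 1"
      using e by auto
    have "vector [0, 0, p u * H u $ i $ j] = (\<Sum>k\<in>UNIV. G $ k *\<^sub>R pd k x u) - (e * h) *\<^sub>R x u \<longleftrightarrow>
      G $ 1 = e * h * u $ 1 \<and> G $ 2 = e * h * u $ 2 \<and>
      p u * H u $ i $ j = G $ 1 * f1 u + G $ 2 * f2 u - e * h * f u"
      by (auto simp: sum_2 pd_x[OF u] x_eq[OF u] vec_eq_iff forall_3)
    also have "\<dots> \<longleftrightarrow> G $ 1 = e * h * u $ 1 \<and> G $ 2 = e * h * u $ 2 \<and>
      p u * H u $ i $ j = p u * (- (e * h))"
      by (auto simp: p_eq[OF u] algebra_simps)
    also have "\<dots> \<longleftrightarrow> G $ 1 = e * h * u $ 1 \<and> G $ 2 = e * h * u $ 2 \<and> H u $ i $ j = - (e * h)"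
      using p_pos[OF u] by (metis mult_cancel_left less_irrefl)
    also have "H u $ i $ j = - (e * h) \<longleftrightarrow> h = - e * H u $ i $ j"
      using e by auto
    finally show ?thesis
      using e by (auto simp: vec_eq_iff forall_2)
  qed
  then show ?thesis
    unfolding gauss_formula_def pd_pd_x[OF u] by (intro the_equality) auto
qed

lemma centroaffine_form_eq:
  assumes "u \<in> M" "e = 1 \<or> e = - 1"
  shows "centroaffine_form e x u = (- e) *\<^sub>R H u"
  by (simp add: centroaffine_form_def gauss_formula_eq[OF assms] vec_eq_iff)

text \<open>The form for the sign \<open>e\<close> is \<open>- e\<close> times the positive definite
  \<open>H\<close>. Since \<open>M\<close> has a point, the sign 1 fails, and the description in
  \<open>centroaffine_sign\<close> has a unique solution.\<close>

lemma convex_with_sign_iff: "convex_with_sign e M x \<longleftrightarrow> e = - 1"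
proof
  assume e: "convex_with_sign e M x"
  show "e = - 1"
  proof (rule ccontr)
    assume "e \<noteq> - 1"
    then have "e = 1"
      using e by (auto simp: convex_with_sign_def)
    obtain u where u: "u \<in> M"
      using nonempty_M by blast
    have "pos_def_matrix (- H u)"
      using e u \<open>e = 1\<close> centroaffine_form_eq[of u e] by (auto simp: convex_with_sign_def)
    then have "0 < axis 1 1 \<bullet> (- H u *v axis 1 1)"
      unfolding pos_def_matrix_def by (metis axis_eq_0_iff zero_neq_one)
    then show False
      using h11_pos[OF u] unfolding quadratic_form_2 by (simp add: axis_def)
  qed
next
  assume "e = - 1"
  then show "convex_with_sign e M x"
    using pos_def_H by (auto simp: convex_with_sign_def centroaffine_form_eq)
qed

lemma centroaffine_sign_eq: "centroaffine_sign M x = - 1"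
  by (simp add: centroaffine_sign_def convex_with_sign_iff)

lemma hyperbolic: "hyperbolic M x"
  by (auto simp: hyperbolic_def locally_strongly_convex_def centroaffine_surface
      convex_with_sign_iff centroaffine_sign_eq)

lemma centroaffine_metric_eq: "u \<in> M \<Longrightarrow> centroaffine_metric M x u = H u"
  by (simp add: centroaffine_metric_def centroaffine_sign_eq centroaffine_form_eq)

lemma induced_connection_eq:
  "u \<in> M \<Longrightarrow> induced_connection M x k i j u = - H u $ i $ j * u $ k"
  by (simp add: induced_connection_def centroaffine_sign_eq gauss_formula_eq)

end


section \<open>A family of metrics of curvature \<open>-1\<close>\<close>

lemma has_derivative_vec_nth [derivative_intros]:
  "((\<lambda>u. u $ i) has_derivative (\<lambda>v. v $ i)) F"
  by (intro bounded_linear_imp_has_derivative bounded_linear_vec_nth)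

text \<open>\<open>matrix_inv\<close> is a choice. A one-sided inverse of a square matrix is
  two-sided and unique, so a single product identifies the chosen matrix.\<close>

lemma matrix_inv_eqI:
  fixes A B :: "real^'n^'n"
  assumes "A ** B = mat 1"
  shows "matrix_inv A = B"
proof -
  have "B ** A = mat 1"
    using assms matrix_left_right_inverse by blast
  then have "\<exists>C. A ** C = mat 1 \<and> C ** A = mat 1"
    using assms by blast
  then have "A ** matrix_inv A = mat 1 \<and> matrix_inv A ** A = mat 1"
    unfolding matrix_inv_def by (rule someI_ex)
  then show ?thesis
    using assms by (metis matrix_mul_assoc matrix_mul_lid matrix_mul_rid)
qed

text \<open>The metric and its symbols agree with their rational formulas only on \<open>M\<close>;
  since \<open>M\<close> is open, this suffices to differentiate them.\<close>

lemma has_partials_pd_cong: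
  assumes "has_partials g a b u" "open M" "u \<in> M" "\<And>w. w \<in> M \<Longrightarrow> f w = g w"
  shows "pd 1 f u = a" "pd 2 f u = b"
  using has_partials_pd[OF assms(1)] pd_cong[OF assms(2-4)] by simp_all

text \<open>The induced connection of a graph is determined by the metric entries and the
  coordinates. Curvature and Tchebychev field can therefore be computed once for both types, with
  \<open>f\<close> and \<open>p\<close> left abstract.\<close>

locale hyperbolic_graph = graph_surface M x f f1 f2 p
    "\<lambda>u. (1 + k * (u $ 1)\<^sup>2) / ((u $ 1)\<^sup>2 + d)" "\<lambda>u. - k * u $ 1 / u $ 2"
    "\<lambda>u. k * ((u $ 1)\<^sup>2 + d) / (u $ 2)\<^sup>2"
  for M x f f1 f2 p and k d :: real +
  assumes k_pos: "k > 0"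
    and u2_pos: "\<And>u. u \<in> M \<Longrightarrow> u $ 2 > 0"
    and denom_pos: "\<And>u. u \<in> M \<Longrightarrow> (u $ 1)\<^sup>2 + d > 0"
begin

abbreviation g where "g \<equiv> centroaffine_metric M x"

lemma metric_eq:
  assumes "u \<in> M"
  shows "g u $ 1 $ 1 = (1 + k * (u $ 1)\<^sup>2) / ((u $ 1)\<^sup>2 + d)" "g u $ 1 $ 2 = - k * u $ 1 / u $ 2"
    "g u $ 2 $ 1 = - k * u $ 1 / u $ 2" "g u $ 2 $ 2 = k * ((u $ 1)\<^sup>2 + d) / (u $ 2)\<^sup>2"
  unfolding centroaffine_metric_eq[OF assms] by (rule H_simps)+

lemma det_metric:
  assumes u: "u \<in> M"
  shows "det (g u) = k / (u $ 2)\<^sup>2"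
proof -
  \<comment> \<open>Making the denominator \<open>w\<close> an atom and eliminating \<open>d\<close>
    instead leaves only the monomial denominators in \<open>b\<close> and \<open>w\<close>; after
    clearing them, a polynomial identity remains. The later computations use the same
    substitution.\<close>
  define a b w where "a = u $ 1" "b = u $ 2" "w = (u $ 1)\<^sup>2 + d"
  have nz: "b \<noteq> 0" "w \<noteq> 0" and d: "d = w - a\<^sup>2"
    using u2_pos[OF u] denom_pos[OF u] by (auto simp: a_b_w_def)
  show ?thesis
    unfolding det_2 metric_eq[OF u] a_b_w_def(1,2)[symmetric] using nz unfolding d
    by (simp add: divide_simps) (simp add: algebra_simps power2_eq_square)
qed

lemma metric_inv:
  assumes "u \<in> M"
  shows "matrix_inv (g u) $ 1 $ 1 = (u $ 1)\<^sup>2 + d" "matrix_inv (g u) $ 1 $ 2 = u $ 1 * u $ 2"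
    "matrix_inv (g u) $ 2 $ 1 = u $ 1 * u $ 2"
    "matrix_inv (g u) $ 2 $ 2 = (u $ 2)\<^sup>2 * (1 + k * (u $ 1)\<^sup>2) / (k * ((u $ 1)\<^sup>2 + d))"
proof -
  have "matrix_inv (g u) = vector [vector [(u $ 1)\<^sup>2 + d, u $ 1 * u $ 2],
     vector [u $ 1 * u $ 2, (u $ 2)\<^sup>2 * (1 + k * (u $ 1)\<^sup>2) / (k * ((u $ 1)\<^sup>2 + d))]]"
  proof (rule matrix_inv_eqI)
    define a b w where "a = u $ 1" "b = u $ 2" "w = (u $ 1)\<^sup>2 + d"
    have nz: "b \<noteq> 0" "w \<noteq> 0" "k \<noteq> 0" and d: "d = w - a\<^sup>2"
      using u2_pos[OF assms] denom_pos[OF assms] k_pos by (auto simp: a_b_w_def)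
    show "g u ** vector [vector [(u $ 1)\<^sup>2 + d, u $ 1 * u $ 2],
        vector [u $ 1 * u $ 2, (u $ 2)\<^sup>2 * (1 + k * (u $ 1)\<^sup>2) / (k * ((u $ 1)\<^sup>2 + d))]] = mat 1"
      unfolding vec_eq_iff forall_2 matrix_matrix_mult_def sum_2 mat_def vec_lambda_beta vector_2
        metric_eq[OF assms] a_b_w_def(1,2)[symmetric]
      using nz unfolding d
      by (simp add: divide_simps) (simp add: algebra_simps power2_eq_square)
  qed
  then show "matrix_inv (g u) $ 1 $ 1 = (u $ 1)\<^sup>2 + d" "matrix_inv (g u) $ 1 $ 2 = u $ 1 * u $ 2"
    "matrix_inv (g u) $ 2 $ 1 = u $ 1 * u $ 2"
    "matrix_inv (g u) $ 2 $ 2 = (u $ 2)\<^sup>2 * (1 + k * (u $ 1)\<^sup>2) / (k * ((u $ 1)\<^sup>2 + d))"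
    by simp_all
qed

section \<open>Christoffel symbols, curvature and Tchebychev field of the family\<close>

lemma pd_metric:
  assumes u: "u \<in> M"
  shows "pd 1 (\<lambda>w. g w $ 1 $ 1) u = - 2 * u $ 1 * (1 - k * d) / ((u $ 1)\<^sup>2 + d)\<^sup>2"
    "pd 2 (\<lambda>w. g w $ 1 $ 1) u = 0"
    "pd 1 (\<lambda>w. g w $ 1 $ 2) u = - k / u $ 2" "pd 2 (\<lambda>w. g w $ 1 $ 2) u = k * u $ 1 / (u $ 2)\<^sup>2"
    "pd 1 (\<lambda>w. g w $ 2 $ 1) u = - k / u $ 2" "pd 2 (\<lambda>w. g w $ 2 $ 1) u = k * u $ 1 / (u $ 2)\<^sup>2"
    "pd 1 (\<lambda>w. g w $ 2 $ 2) u = 2 * k * u $ 1 / (u $ 2)\<^sup>2"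
    "pd 2 (\<lambda>w. g w $ 2 $ 2) u = - 2 * k * ((u $ 1)\<^sup>2 + d) / (u $ 2) ^ 3"
proof -
  note nz = denom_pos[OF u, THEN less_imp_neq, symmetric] u2_pos[OF u, THEN less_imp_neq, symmetric]
  have E: "has_partials (\<lambda>w. (1 + k * (w $ 1)\<^sup>2) / ((w $ 1)\<^sup>2 + d))
      (- 2 * u $ 1 * (1 - k * d) / ((u $ 1)\<^sup>2 + d)\<^sup>2) 0 u"
    using nz by (auto intro!: derivative_eq_intros simp: field_simps power2_eq_square)
  show "pd 1 (\<lambda>w. g w $ 1 $ 1) u = - 2 * u $ 1 * (1 - k * d) / ((u $ 1)\<^sup>2 + d)\<^sup>2"
    "pd 2 (\<lambda>w. g w $ 1 $ 1) u = 0"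
    by (rule has_partials_pd_cong[OF E open_M u metric_eq(1)], assumption)+
  have F: "has_partials (\<lambda>w. - k * w $ 1 / w $ 2) (- k / u $ 2) (k * u $ 1 / (u $ 2)\<^sup>2) u"
    using nz by (auto intro!: derivative_eq_intros simp: field_simps power2_eq_square)
  show "pd 1 (\<lambda>w. g w $ 1 $ 2) u = - k / u $ 2" "pd 2 (\<lambda>w. g w $ 1 $ 2) u = k * u $ 1 / (u $ 2)\<^sup>2"
    by (rule has_partials_pd_cong[OF F open_M u metric_eq(2)], assumption)+
  show "pd 1 (\<lambda>w. g w $ 2 $ 1) u = - k / u $ 2" "pd 2 (\<lambda>w. g w $ 2 $ 1) u = k * u $ 1 / (u $ 2)\<^sup>2"
    by (rule has_partials_pd_cong[OF F open_M u metric_eq(3)], assumption)+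
  have G: "has_partials (\<lambda>w. k * ((w $ 1)\<^sup>2 + d) / (w $ 2)\<^sup>2)
      (2 * k * u $ 1 / (u $ 2)\<^sup>2) (- 2 * k * ((u $ 1)\<^sup>2 + d) / (u $ 2) ^ 3) u"
    using nz by (auto intro!: derivative_eq_intros simp: field_simps power2_eq_square power3_eq_cube)
  show "pd 1 (\<lambda>w. g w $ 2 $ 2) u = 2 * k * u $ 1 / (u $ 2)\<^sup>2"
    "pd 2 (\<lambda>w. g w $ 2 $ 2) u = - 2 * k * ((u $ 1)\<^sup>2 + d) / (u $ 2) ^ 3"
    by (rule has_partials_pd_cong[OF G open_M u metric_eq(4)], assumption)+
qed

lemma levi_civita_metric:
  assumes u: "u \<in> M"
  shows "levi_civita g 1 1 1 u = - u $ 1 * (1 + k * (u $ 1)\<^sup>2) / ((u $ 1)\<^sup>2 + d)"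
    "levi_civita g 2 1 1 u = - (u $ 1)\<^sup>2 * u $ 2 * (1 - k * d) / ((u $ 1)\<^sup>2 + d)\<^sup>2
        - u $ 2 * (1 + k * (u $ 1)\<^sup>2) / ((u $ 1)\<^sup>2 + d)"
    "levi_civita g 1 1 2 u = k * (u $ 1)\<^sup>2 / u $ 2" "levi_civita g 1 2 1 u = k * (u $ 1)\<^sup>2 / u $ 2"
    "levi_civita g 2 1 2 u = u $ 1 * (1 + k * (u $ 1)\<^sup>2) / ((u $ 1)\<^sup>2 + d)"
    "levi_civita g 2 2 1 u = u $ 1 * (1 + k * (u $ 1)\<^sup>2) / ((u $ 1)\<^sup>2 + d)"
    "levi_civita g 1 2 2 u = - k * u $ 1 * ((u $ 1)\<^sup>2 + d) / (u $ 2)\<^sup>2"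
    "levi_civita g 2 2 2 u = - (1 + k * (u $ 1)\<^sup>2) / u $ 2"
proof -
  define a b w where "a = u $ 1" "b = u $ 2" "w = (u $ 1)\<^sup>2 + d"
  have nz: "b \<noteq> 0" "w \<noteq> 0" "k \<noteq> 0" and d: "d = w - a\<^sup>2"
    using u2_pos[OF u] denom_pos[OF u] k_pos by (auto simp: a_b_w_def)
  note ev = levi_civita_def sum_2 metric_inv[OF u] pd_metric[OF u] a_b_w_def(1,2)[symmetric]
  show "levi_civita g 1 1 1 u = - u $ 1 * (1 + k * (u $ 1)\<^sup>2) / ((u $ 1)\<^sup>2 + d)"
    "levi_civita g 2 1 1 u = - (u $ 1)\<^sup>2 * u $ 2 * (1 - k * d) / ((u $ 1)\<^sup>2 + d)\<^sup>2
        - u $ 2 * (1 + k * (u $ 1)\<^sup>2) / ((u $ 1)\<^sup>2 + d)"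
    "levi_civita g 1 1 2 u = k * (u $ 1)\<^sup>2 / u $ 2" "levi_civita g 1 2 1 u = k * (u $ 1)\<^sup>2 / u $ 2"
    "levi_civita g 2 1 2 u = u $ 1 * (1 + k * (u $ 1)\<^sup>2) / ((u $ 1)\<^sup>2 + d)"
    "levi_civita g 2 2 1 u = u $ 1 * (1 + k * (u $ 1)\<^sup>2) / ((u $ 1)\<^sup>2 + d)"
    "levi_civita g 1 2 2 u = - k * u $ 1 * ((u $ 1)\<^sup>2 + d) / (u $ 2)\<^sup>2"
    "levi_civita g 2 2 2 u = - (1 + k * (u $ 1)\<^sup>2) / u $ 2"
    unfolding ev using nz unfolding d
    by (simp_all add: divide_simps, simp_all add: algebra_simps power2_eq_square power3_eq_cube)
qed

lemma gauss_curvature_metric: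
  assumes u: "u \<in> M"
  shows "gauss_curvature g u = - 1"
proof -
  define a b w where "a = u $ 1" "b = u $ 2" "w = (u $ 1)\<^sup>2 + d"
  have nz: "b \<noteq> 0" "w \<noteq> 0" "k \<noteq> 0" and d: "d = w - a\<^sup>2"
    using u2_pos[OF u] denom_pos[OF u] k_pos by (auto simp: a_b_w_def)
  note nz' = denom_pos[OF u, THEN less_imp_neq, symmetric] u2_pos[OF u, THEN less_imp_neq, symmetric]
  have "has_partials (\<lambda>u. - k * u $ 1 * ((u $ 1)\<^sup>2 + d) / (u $ 2)\<^sup>2)
      (- k * (3 * a\<^sup>2 + d) / b\<^sup>2) (2 * k * a * w / b ^ 3) u"
    using nz' unfolding a_b_w_def
    by (auto intro!: derivative_eq_intros simp: field_simps power2_eq_square power3_eq_cube)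
  then have p122: "pd 1 (levi_civita g 1 2 2) u = - k * (3 * a\<^sup>2 + d) / b\<^sup>2"
    by (rule has_partials_pd_cong[OF _ open_M u levi_civita_metric(7)])
  have "has_partials (\<lambda>u. - (1 + k * (u $ 1)\<^sup>2) / u $ 2)
      (- 2 * k * a / b) ((1 + k * a\<^sup>2) / b\<^sup>2) u"
    using nz' unfolding a_b_w_def
    by (auto intro!: derivative_eq_intros simp: field_simps power2_eq_square power3_eq_cube)
  then have p222: "pd 1 (levi_civita g 2 2 2) u = - 2 * k * a / b"
    by (rule has_partials_pd_cong[OF _ open_M u levi_civita_metric(8)])
  have "has_partials (\<lambda>u. k * (u $ 1)\<^sup>2 / u $ 2) (2 * k * a / b) (- k * a\<^sup>2 / b\<^sup>2) u"
    using nz' unfolding a_b_w_def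
    by (auto intro!: derivative_eq_intros simp: field_simps power2_eq_square power3_eq_cube)
  then have p112: "pd 2 (levi_civita g 1 1 2) u = - k * a\<^sup>2 / b\<^sup>2"
    by (rule has_partials_pd_cong[OF _ open_M u levi_civita_metric(3)])
  have "has_partials (\<lambda>u. u $ 1 * (1 + k * (u $ 1)\<^sup>2) / ((u $ 1)\<^sup>2 + d))
      (((1 + 3 * k * a\<^sup>2) * w - 2 * a\<^sup>2 * (1 + k * a\<^sup>2)) / w\<^sup>2) 0 u"
    using nz' unfolding a_b_w_def
    by (auto intro!: derivative_eq_intros simp: field_simps power2_eq_square power3_eq_cube)
  then have p212: "pd 2 (levi_civita g 2 1 2) u = 0"
    by (rule has_partials_pd_cong[OF _ open_M u levi_civita_metric(5)])
  note levi = levi_civita_metric[OF u]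
  \<comment> \<open>Both values are those of constant curvature -1, where R(d_1, d_2) d_2 = - h_22
    d_1 + h_12 d_2 for the coordinate fields d_1, d_2.\<close>
  have R1: "riemann (levi_civita g) 1 1 2 2 u = - k * w / b\<^sup>2"
    unfolding riemann_def sum_2 p122 p112 levi a_b_w_def(1,2)[symmetric] using nz unfolding d
    by (simp add: divide_simps, simp add: algebra_simps power2_eq_square power3_eq_cube)
  have R2: "riemann (levi_civita g) 2 1 2 2 u = - k * a / b"
    unfolding riemann_def sum_2 p222 p212 levi a_b_w_def(1,2)[symmetric] using nz unfolding d
    by (simp add: divide_simps, simp add: algebra_simps power2_eq_square power3_eq_cube)
  show ?thesis
    unfolding gauss_curvature_def sum_2 R1 R2 det_metric[OF u] metric_eq[OF u] a_b_w_def(1,2)[symmetric]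
    using nz unfolding d by (simp add: divide_simps) (simp add: algebra_simps power2_eq_square)
qed

text \<open>The induced connection has trace - 2 u_k and the Levi-Civita symbols have trace minus
  the Laplacian of u_k. Thus T measures the failure of Laplacian u_k = 2 u_k; this equation holds
  for the first coordinate.\<close>

lemma tchebychev_field_eq:
  assumes u: "u \<in> M"
  shows "tchebychev_field M x u $ 1 = 0"
    "tchebychev_field M x u $ 2 = (1 / k - d) / 2 * u $ 2 / ((u $ 1)\<^sup>2 + d)"
proof -
  define a b w where "a = u $ 1" "b = u $ 2" "w = (u $ 1)\<^sup>2 + d"
  have nz: "b \<noteq> 0" "w \<noteq> 0" "k \<noteq> 0" and d: "d = w - a\<^sup>2"
    using u2_pos[OF u] denom_pos[OF u] k_pos by (auto simp: a_b_w_def)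
  note ev = tchebychev_field_def vec_lambda_beta sum_2 difference_tensor_def metric_inv[OF u]
    levi_civita_metric[OF u] induced_connection_eq[OF u] H_simps a_b_w_def(1,2)[symmetric]
  show "tchebychev_field M x u $ 1 = 0"
    "tchebychev_field M x u $ 2 = (1 / k - d) / 2 * u $ 2 / ((u $ 1)\<^sup>2 + d)"
    unfolding ev using nz unfolding d
    by (simp_all add: divide_simps, simp_all add: algebra_simps power2_eq_square power3_eq_cube)
qed

lemma centroaffine_extremal: "centroaffine_extremal M x"
  unfolding centroaffine_extremal_def
proof (intro conjI ballI)
  show "locally_strongly_convex M x"
    using hyperbolic by (simp add: hyperbolic_def)
  fix u assume u: "u \<in> M"
  note nz = denom_pos[OF u, THEN less_imp_neq, symmetric] u2_pos[OF u, THEN less_imp_neq, symmetric]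
  have "has_partials (\<lambda>u. 0) 0 0 u"
    by (auto intro!: derivative_eq_intros)
  then have p1: "pd 1 (\<lambda>w. tchebychev_field M x w $ 1) u = 0"
    by (rule has_partials_pd_cong[OF _ open_M u tchebychev_field_eq(1)])
  have "has_partials (\<lambda>u. c * u $ 2 / ((u $ 1)\<^sup>2 + d))
      (- 2 * c * u $ 1 * u $ 2 / ((u $ 1)\<^sup>2 + d)\<^sup>2) (c / ((u $ 1)\<^sup>2 + d)) u" for c
    using nz by (auto intro!: derivative_eq_intros simp: fun_eq_iff divide_simps)
      (simp add: algebra_simps power2_eq_square)
  from this[of "(1 / k - d) / 2"]
  have p2: "pd 2 (\<lambda>w. tchebychev_field M x w $ 2) u = (1 / k - d) / 2 / ((u $ 1)\<^sup>2 + d)"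
    by (rule has_partials_pd_cong[OF _ open_M u tchebychev_field_eq(2)])
  \<comment> \<open>Only the second component contributes. The contracted symbols in that direction
    are -1 / b, the logarithmic derivative of the volume density sqrt k / b, and this cancels the
    derivative of a component linear in b.\<close>
  show "divergence (levi_civita g) (tchebychev_field M x) u = 0"
    unfolding divergence_def sum_2 p1 p2 tchebychev_field_eq[OF u] levi_civita_metric[OF u]
    using nz k_pos by (simp add: divide_simps) (simp add: algebra_simps power2_eq_square)
qed

lemma riemannian_domain: "riemannian_domain M g"
proof
  have "continuous_on M (\<lambda>u. (1 + k * (u $ 1)\<^sup>2) / ((u $ 1)\<^sup>2 + d))"
      "continuous_on M (\<lambda>u. - k * u $ 1 / u $ 2)"
      "continuous_on M (\<lambda>u. k * ((u $ 1)\<^sup>2 + d) / (u $ 2)\<^sup>2)"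
    using denom_pos u2_pos by (force intro!: continuous_intros continuous_on_component)+
  then have "continuous_on M (\<lambda>u. g u $ i $ j)" for i j
    using exhaust_2[of i] exhaust_2[of j]
    by (auto simp: metric_eq cong: continuous_on_cong)
  then have "continuous_on M (\<lambda>u. \<chi> i j. g u $ i $ j)"
    by (intro continuous_on_vec_lambda)
  then show "continuous_on M g"
    by simp
qed (use open_M connected_M pos_def_H centroaffine_metric_eq in auto)

text \<open>The form is diagonal in da and d\<tau> = db / b - a da / w; the Lipschitz estimates are
  read off from the two squares.\<close>

lemma quadratic_form_metric:
  assumes u: "u \<in> M"
  shows "v \<bullet> (g u *v v) = (v $ 1)\<^sup>2 / ((u $ 1)\<^sup>2 + d)
    + k * ((u $ 1)\<^sup>2 + d) * (v $ 2 / u $ 2 - u $ 1 * v $ 1 / ((u $ 1)\<^sup>2 + d))\<^sup>2"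
proof -
  define a b w where "a = u $ 1" "b = u $ 2" "w = (u $ 1)\<^sup>2 + d"
  have nz: "b \<noteq> 0" "w \<noteq> 0" and d: "d = w - a\<^sup>2"
    using u2_pos[OF u] denom_pos[OF u] by (auto simp: a_b_w_def)
  show ?thesis
    unfolding quadratic_form_2 metric_eq[OF u] a_b_w_def(1,2)[symmetric] using nz unfolding d
    by (simp add: divide_simps) (simp add: algebra_simps power2_eq_square)
qed

end


section \<open>The surfaces of type (i)\<close>

lemma compact_rectangle:
  "compact {u :: real^2. l1 \<le> u $ 1 \<and> u $ 1 \<le> r1 \<and> l2 \<le> u $ 2 \<and> u $ 2 \<le> r2}"
proof -
  have "{u :: real^2. l1 \<le> u $ 1 \<and> u $ 1 \<le> r1 \<and> l2 \<le> u $ 2 \<and> u $ 2 \<le> r2}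
      = cbox (vector [l1, l2]) (vector [r1, r2])"
    by (auto simp: mem_box_cart forall_2)
  then show ?thesis
    by simp
qed

text \<open>Both parametrizations are sections of the projection to the first two coordinates, so a
  point of the common image has the same preimage under each.\<close>

lemma in_graph_coordinates_imp:
  assumes "in_graph_coordinates S M x" "S = (\<lambda>u. vector [u $ 1, u $ 2, f u]) ` D"
  shows "M = D" "\<And>u. u \<in> M \<Longrightarrow> x u = vector [u $ 1, u $ 2, f u]"
proof -
  have x: "x ` M = (\<lambda>u. vector [u $ 1, u $ 2, f u]) ` D" "\<And>u. u \<in> M \<Longrightarrow> x u $ 1 = u $ 1 \<and> x u $ 2 = u $ 2"
    using assms by (auto simp: in_graph_coordinates_def)
  have *: "u \<in> D \<and> x u = vector [u $ 1, u $ 2, f u]" if u: "u \<in> M" for u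
  proof -
    obtain w where w: "w \<in> D" "x u = vector [w $ 1, w $ 2, f w]"
      using x(1) u by blast
    then have "w = u"
      using x(2)[OF u] by (simp add: vec_eq_iff forall_2)
    then show ?thesis
      using w by simp
  qed
  have "u \<in> M" if u: "u \<in> D" for u
  proof -
    obtain w where w: "w \<in> M" "x w = vector [u $ 1, u $ 2, f u]"
      using x(1) u by (metis (no_types, lifting) imageE imageI)
    then have "w = u"
      using x(2)[OF w(1)] by (simp add: vec_eq_iff forall_2)
    then show ?thesis
      using w by simp
  qed
  then show "M = D" "\<And>u. u \<in> M \<Longrightarrow> x u = vector [u $ 1, u $ 2, f u]"
    using * by auto
qed

lemma graph_over_planeI:
  assumes "\<And>y1 y2. \<exists>!t. vector [y1, y2, t] \<in> S"
  shows "graph_over_plane S"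
  unfolding graph_over_plane_def
proof (intro exI set_eqI iffI)
  let ?F = "\<lambda>y1 y2. THE t. vector [y1, y2, t] \<in> S"
  fix q :: "real^3"
  have q: "q = vector [q $ 1, q $ 2, q $ 3]"
    by (simp add: vec_eq_iff forall_3)
  show "q \<in> {vector [y1, y2, ?F y1 y2] | y1 y2. True}" if "q \<in> S"
  proof -
    have "?F (q $ 1) (q $ 2) = q $ 3"
      using that q assms[of "q $ 1" "q $ 2"] by (intro the1_equality) auto
    then show ?thesis
      using q by (intro CollectI exI[of _ "q $ 1"] exI[of _ "q $ 2"]) simp
  qed
  show "q \<in> S" if "q \<in> {vector [y1, y2, ?F y1 y2] | y1 y2. True}"
    using that theI'[OF assms] by auto
qed

text \<open>\<open>B\<close> is the inverse of \<open>A\<close> and takes the vertical line over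
  (y1, y2) to a line along its third column. The graph property can therefore be tested on
  \<open>S\<close> itself.\<close>

lemma graph_over_plane_image:
  fixes A B :: "real^3^3"
  assumes "A ** B = mat 1" and "\<And>y1 y2. \<exists>!t. B *v vector [y1, y2, t] \<in> S"
  shows "invertible A \<and> graph_over_plane ((\<lambda>q. A *v q) ` S)"
proof
  have BA: "B ** A = mat 1"
    using assms(1) matrix_left_right_inverse by blast
  then show "invertible A"
    using assms(1) unfolding invertible_def by blast
  have "q \<in> (\<lambda>q. A *v q) ` S \<longleftrightarrow> B *v q \<in> S" for q
  proof
    assume "q \<in> (\<lambda>q. A *v q) ` S"
    then show "B *v q \<in> S"
      using BA by (auto simp: matrix_vector_mul_assoc)
  next
    assume "B *v q \<in> S"
    then have "A *v (B *v q) \<in> (\<lambda>q. A *v q) ` S"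
      by blast
    then show "q \<in> (\<lambda>q. A *v q) ` S"
      by (simp add: matrix_vector_mul_assoc assms(1))
  qed
  then show "graph_over_plane ((\<lambda>q. A *v q) ` S)"
    using assms(2) by (intro graph_over_planeI) simp
qed

section \<open>Height function and completeness for type (i)\<close>

definition quadrant :: "(real^2) set" where
  "quadrant = {u. 0 < u $ 1 \<and> 0 < u $ 2}"

definition height_i :: "real^2 \<Rightarrow> real" where
  "height_i u = 1 / u $ 1 + u $ 1 * (ln (u $ 1) - ln (u $ 2))"

lemma surface_i_eq: "surface_i = (\<lambda>u. vector [u $ 1, u $ 2, height_i u]) ` quadrant"
proof (intro set_eqI iffI)
  fix q assume q: "q \<in> surface_i"
  then have "q = vector [q $ 1, q $ 2, height_i (vector [q $ 1, q $ 2])]"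
    by (simp add: surface_i_def height_i_def vec_eq_iff forall_3)
  moreover have "vector [q $ 1, q $ 2] \<in> quadrant"
    using q by (simp add: surface_i_def quadrant_def)
  ultimately show "q \<in> (\<lambda>u. vector [u $ 1, u $ 2, height_i u]) ` quadrant"
    by (intro image_eqI[of _ _ "vector [q $ 1, q $ 2]"]) simp_all
qed (auto simp: surface_i_def quadrant_def height_i_def)

lemma open_halfplane: "open {u :: real^2. 0 < u $ i}"
  by (intro open_Collect_less continuous_intros continuous_on_component)

lemma convex_halfplane: "convex {u :: real^2. 0 < u $ i}"
  unfolding cart_eq_inner_axis by (subst inner_commute) (rule convex_halfspace_gt)

lemma quadrant_eq: "quadrant = {u. 0 < u $ 1} \<inter> {u. 0 < u $ 2}"
  by (auto simp: quadrant_def)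

lemma hyperbolic_graph_i:
  assumes "\<And>u. u \<in> quadrant \<Longrightarrow> x u = vector [u $ 1, u $ 2, height_i u]"
  shows "hyperbolic_graph quadrant x height_i (\<lambda>u. 1 - 1 / (u $ 1)\<^sup>2 + ln (u $ 1) - ln (u $ 2))
    (\<lambda>u. - u $ 1 / u $ 2) (\<lambda>u. 2 / u $ 1) (1 / 2) 0"
proof unfold_locales
  show "open quadrant"
    unfolding quadrant_eq by (intro open_Int open_halfplane)
  show "connected quadrant"
    unfolding quadrant_eq by (intro convex_connected convex_Int convex_halfplane)
  have "vector [1, 1] \<in> quadrant"
    by (simp add: quadrant_def)
  then show "quadrant \<noteq> {}"
    by blast
  show "smooth_on height_i quadrant"
    unfolding smooth_on_def
  proof
    fix k
    \<comment> \<open>Quotient and difference become a power with exponent -1 and a product with -1,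
      so the closure rules for sums, products, powers and logarithms suffice.\<close>
    have "Ck_on k (\<lambda>u. (u $ 1) powr (-1) + u $ 1 * (ln (u $ 1) + (-1) * ln (u $ 2))) quadrant"
      by (intro Ck_on_add Ck_on_mult Ck_on_powr Ck_on_ln Ck_on_const Ck_on_vec_nth \<open>open quadrant\<close>)
        (auto simp: quadrant_def)
    moreover have "height_i u = (u $ 1) powr (-1) + u $ 1 * (ln (u $ 1) + (-1) * ln (u $ 2))"
      if "u \<in> quadrant" for u
      using that by (simp add: height_i_def quadrant_def powr_minus_divide)
    ultimately show "Ck_on k height_i quadrant"
      by (simp add: Ck_on_cong[OF \<open>open quadrant\<close>, of height_i])
  qed
  fix u assume "u \<in> quadrant"
  then have pos: "u $ 1 > 0" "u $ 2 > 0"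
    by (auto simp: quadrant_def)
  then show "has_partials height_i (1 - 1 / (u $ 1)\<^sup>2 + ln (u $ 1) - ln (u $ 2)) (- u $ 1 / u $ 2) u"
    unfolding height_i_def
    by (auto intro!: derivative_eq_intros)
      (simp add: fun_eq_iff divide_simps, simp add: algebra_simps power2_eq_square power4_eq_xxxx)
  show "has_partials (\<lambda>u. 1 - 1 / (u $ 1)\<^sup>2 + ln (u $ 1) - ln (u $ 2))
      (2 / u $ 1 * ((1 + 1 / 2 * (u $ 1)\<^sup>2) / ((u $ 1)\<^sup>2 + 0))) (2 / u $ 1 * (- (1 / 2) * u $ 1 / u $ 2)) u"
    using pos by (auto intro!: derivative_eq_intros)
      (simp add: fun_eq_iff divide_simps, simp add: algebra_simps power2_eq_square power3_eq_cube power4_eq_xxxx)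
  show "has_partials (\<lambda>u. - u $ 1 / u $ 2) (2 / u $ 1 * (- (1 / 2) * u $ 1 / u $ 2))
      (2 / u $ 1 * (1 / 2 * ((u $ 1)\<^sup>2 + 0) / (u $ 2)\<^sup>2)) u"
    using pos by (auto intro!: derivative_eq_intros)
      (simp add: fun_eq_iff divide_simps, simp add: algebra_simps power2_eq_square power4_eq_xxxx)
  show "2 / u $ 1 = height_i u - u $ 1 * (1 - 1 / (u $ 1)\<^sup>2 + ln (u $ 1) - ln (u $ 2)) - u $ 2 * (- u $ 1 / u $ 2)"
    using pos by (simp add: height_i_def field_simps power2_eq_square)
  show "0 < (1 + 1 / 2 * (u $ 1)\<^sup>2) / ((u $ 1)\<^sup>2 + 0) * (1 / 2 * ((u $ 1)\<^sup>2 + 0) / (u $ 2)\<^sup>2)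
      - (- (1 / 2) * u $ 1 / u $ 2)\<^sup>2"
    using pos by (simp add: field_simps power2_eq_square)
qed (use assms in \<open>auto simp: quadrant_def intro!: divide_pos_pos add_pos_nonneg\<close>)

text \<open>The exponential of the Lipschitz function is, up to a factor, the hyperbolic cosine of the
  distance from \<open>(0, 1)\<close> in the half-plane model with coordinates
  \<open>((ln u\<^sub>1 - ln u\<^sub>2) / \<surd>2, 1 / u\<^sub>1)\<close>.\<close>

lemma centroaffine_complete_i:
  assumes x: "\<And>u. u \<in> quadrant \<Longrightarrow> x u = vector [u $ 1, u $ 2, height_i u]"
  shows "centroaffine_complete quadrant x"
proof -
  interpret hyperbolic_graph quadrant x height_i "\<lambda>u. 1 - 1 / (u $ 1)\<^sup>2 + ln (u $ 1) - ln (u $ 2)"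
      "\<lambda>u. - u $ 1 / u $ 2" "\<lambda>u. 2 / u $ 1" "1 / 2" 0
    using hyperbolic_graph_i[OF x] .
  interpret R: riemannian_domain quadrant g
    by (rule riemannian_domain)
  define l where "l u = ln (u $ 1) - ln (u $ 2)" for u :: "real^2"
  define N where "N u = u $ 1 + u $ 1 * (l u)\<^sup>2 / 2 + 1 / u $ 1" for u :: "real^2"
  define N' where "N' u v = v $ 1 / u $ 1 * (u $ 1 + u $ 1 * (l u)\<^sup>2 / 2 - 1 / u $ 1)
      + l u * (u $ 1 * (v $ 1 / u $ 1 - v $ 2 / u $ 2))" for u v :: "real^2"
  have N_pos: "N u > 0" if "u \<in> quadrant" for u
    using that by (auto simp: N_def quadrant_def intro!: add_pos_nonneg add_nonneg_pos)
  have "complete_metric quadrant g"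
  proof (rule R.complete_if_proper_Lipschitz_map[where \<Phi> = "\<lambda>u. ln (N u)" and \<Phi>' = "\<lambda>u v. N' u v / N u" and C = 1])
    fix u :: "real^2" assume u: "u \<in> quadrant"
    then have pos: "u $ 1 > 0" "u $ 2 > 0"
      by (auto simp: quadrant_def)
    have "(l has_derivative (\<lambda>v. v $ 1 / u $ 1 - v $ 2 / u $ 2)) (at u)"
      unfolding l_def using pos by (auto intro!: derivative_eq_intros simp: fun_eq_iff divide_inverse)
    then have "(N has_derivative N' u) (at u)"
      unfolding N_def N'_def using pos
      by (auto intro!: derivative_eq_intros)
        (simp add: fun_eq_iff divide_simps, simp add: algebra_simps power2_eq_square power3_eq_cube power4_eq_xxxx)
    from has_derivative_ln[OF N_pos[OF u] this]
    show "((\<lambda>u. ln (N u)) has_derivative (\<lambda>v. N' u v / N u)) (at u)"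
      by (simp add: divide_inverse mult.commute)
    fix v :: "real^2"
    \<comment> \<open>\<open>s\<close> and r / sqrt 2 are the components of \<open>v\<close> in an
      orthonormal coframe, and \<open>N' u v\<close> becomes the bilinear expression s a + l
      r.\<close>
    define s r a where "s = v $ 1 / u $ 1" "r = u $ 1 * (v $ 1 / u $ 1 - v $ 2 / u $ 2)"
      "a = u $ 1 + u $ 1 * (l u)\<^sup>2 / 2 - 1 / u $ 1"
    have Q: "v \<bullet> (g u *v v) = s\<^sup>2 + r\<^sup>2 / 2"
      unfolding quadratic_form_metric[OF u] s_r_a_def using pos
      by (simp add: divide_simps) (simp add: algebra_simps power2_eq_square power4_eq_xxxx)
    have "(N u)\<^sup>2 - a\<^sup>2 = 4 + 2 * (l u)\<^sup>2"
      unfolding N_def s_r_a_def using pos by (simp add: field_simps power2_eq_square)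
    \<comment> \<open>This is Lagrange's identity for (s, r / sqrt 2) and (a, sqrt 2 l), whose
      squared norms are the metric form and N^2 - 4. Geometrically, the gradient of cosh of the
      distance has squared norm cosh^2 - 1.\<close>
    then have "(s\<^sup>2 + r\<^sup>2 / 2) * (N u)\<^sup>2 = (s * a + l u * r)\<^sup>2 + (2 * s * l u - r * a)\<^sup>2 / 2
        + 4 * (s\<^sup>2 + r\<^sup>2 / 2)"
      by (simp add: field_simps power2_eq_square)
    moreover have "N' u v = s * a + l u * r"
      by (simp add: N'_def s_r_a_def)
    ultimately have "(N' u v)\<^sup>2 \<le> (s\<^sup>2 + r\<^sup>2 / 2) * (N u)\<^sup>2"
      by simp
    then have "(N' u v / N u)\<^sup>2 \<le> v \<bullet> (g u *v v)"
      using N_pos[OF u] by (simp add: Q power_divide divide_le_eq)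
    then show "norm (N' u v / N u) \<le> 1 * sqrt (v \<bullet> (g u *v v))"
      using real_le_rsqrt[of "\<bar>N' u v / N u\<bar>"] by (simp add: power_divide)
  next
    fix R :: real
    define B where "B = exp R"
    \<comment> \<open>The three positive summands of \<open>N\<close> are each at most
      \<open>B\<close>. They bound u_1 from both sides and then \<open>l\<close> by 2 B; the bounds
      on u_2 come from u_2 = u_1 exp (- l).\<close>
    let ?K = "{u :: real^2. 1 / B \<le> u $ 1 \<and> u $ 1 \<le> B \<and> exp (- 2 * B) / B \<le> u $ 2 \<and> u $ 2 \<le> B * exp (2 * B)}"
    have B: "B > 0"
      by (simp add: B_def)
    have "?K \<subseteq> quadrant"
      unfolding quadrant_def using B
      by (auto intro: less_le_trans[of 0 "1 / B"] less_le_trans[of 0 "exp (- 2 * B) / B"])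
    moreover have "{u \<in> quadrant. norm (ln (N u)) \<le> R} \<subseteq> ?K"
    proof safe
      fix u assume u: "u \<in> quadrant" and "norm (ln (N u)) \<le> R"
      then have pos: "u $ 1 > 0" "u $ 2 > 0" and "ln (N u) \<le> R"
        by (auto simp: quadrant_def)
      then have "N u \<le> B"
        using N_pos[OF u] unfolding B_def by (metis exp_le_cancel_iff exp_ln)
      moreover have "0 \<le> u $ 1 * (l u)\<^sup>2 / 2" "0 < 1 / u $ 1"
        using pos by auto
      ultimately have *: "u $ 1 \<le> B" "1 / u $ 1 \<le> B" "u $ 1 * (l u)\<^sup>2 / 2 \<le> B"
        using pos unfolding N_def by linarith+
      show "u $ 1 \<le> B"
        by fact
      show u1: "1 / B \<le> u $ 1"
        using * pos B by (simp add: field_simps)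
      have "(l u)\<^sup>2 \<le> 2 * B * (1 / u $ 1)"
        using *(3) pos by (simp add: field_simps)
      also have "\<dots> \<le> 2 * B * B"
        using *(2) B by (intro mult_left_mono) auto
      also have "\<dots> \<le> (2 * B)\<^sup>2"
        using B by (simp add: power2_eq_square)
      finally have "\<bar>l u\<bar> \<le> 2 * B"
        using B abs_le_square_iff[of "l u" "2 * B"] by simp
      then have l: "exp (- 2 * B) \<le> exp (- l u)" "exp (- l u) \<le> exp (2 * B)"
        by auto
      have "u $ 2 = u $ 1 * exp (- l u)"
        using pos by (simp add: l_def exp_diff)
      moreover have "1 / B * exp (- 2 * B) \<le> u $ 1 * exp (- l u)"
        using u1 l B pos by (intro mult_mono) auto
      moreover have "u $ 1 * exp (- l u) \<le> B * exp (2 * B)"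
        using * l B by (intro mult_mono) auto
      ultimately show "exp (- 2 * B) / B \<le> u $ 2" "u $ 2 \<le> B * exp (2 * B)"
        by simp_all
    qed
    ultimately show "\<exists>K. compact K \<and> K \<subseteq> quadrant \<and> {u \<in> quadrant. norm (ln (N u)) \<le> R} \<subseteq> K"
      by (intro exI[of _ ?K] conjI compact_rectangle)
  qed simp
  then show ?thesis
    by (simp add: centroaffine_complete_def)
qed

lemma component_le_norm_vector_3:
  "\<bar>a\<bar> \<le> norm (vector [a, b, c] :: real^3)" "\<bar>b\<bar> \<le> norm (vector [a, b, c] :: real^3)"
  "\<bar>c\<bar> \<le> norm (vector [a, b, c] :: real^3)"
  using component_le_norm_cart[of "vector [a, b, c] :: real^3" 1]
    component_le_norm_cart[of "vector [a, b, c] :: real^3" 2]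
    component_le_norm_cart[of "vector [a, b, c] :: real^3" 3] by simp_all

text \<open>The height explodes at the boundary while u_1 and u_2 stay bounded. Near u_1 = 0 the
  term 1 / u_1 wins, because ln z \<le> z - 1 bounds the logarithmic term below by u_1 - u_2; once
  u_1 is bounded away from 0, the term - u_1 ln u_2 keeps u_2 away from 0.\<close>

lemma euclidean_complete_i:
  assumes x: "\<And>u. u \<in> quadrant \<Longrightarrow> x u = vector [u $ 1, u $ 2, height_i u]"
  shows "euclidean_complete quadrant x"
proof -
  interpret hyperbolic_graph quadrant x height_i "\<lambda>u. 1 - 1 / (u $ 1)\<^sup>2 + ln (u $ 1) - ln (u $ 2)"
      "\<lambda>u. - u $ 1 / u $ 2" "\<lambda>u. 2 / u $ 1" "1 / 2" 0
    using hyperbolic_graph_i[OF x] .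
  show ?thesis
  proof (rule euclidean_complete_if_proper[OF centroaffine_surface])
    fix R0 :: real
    define R where "R = max R0 1"
    \<comment> \<open>The exponent adds the two bounds obtained below: ln u_1 \<ge> - ln (2 R), and
      ln u_1 - ln u_2 \<le> 2 R^2.\<close>
    define b where "b = exp (- ln (2 * R) - 2 * R\<^sup>2)"
    let ?K = "{u :: real^2. 1 / (2 * R) \<le> u $ 1 \<and> u $ 1 \<le> R \<and> b \<le> u $ 2 \<and> u $ 2 \<le> R}"
    have R: "R \<ge> 1" "R0 \<le> R" and b: "b > 0"
      by (auto simp: R_def b_def)
    have "?K \<subseteq> quadrant"
      unfolding quadrant_def using R b
      by (auto intro: less_le_trans[of 0 "1 / (2 * R)"] less_le_trans[of 0 b])
    moreover have "{u \<in> quadrant. norm (x u) \<le> R0} \<subseteq> ?K"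
    proof safe
      fix u assume u: "u \<in> quadrant" and n: "norm (x u) \<le> R0"
      have pos: "u $ 1 > 0" "u $ 2 > 0"
        using u by (auto simp: quadrant_def)
      have le: "u $ 1 \<le> R" "u $ 2 \<le> R" "height_i u \<le> R"
        using component_le_norm_vector_3[where a = "u $ 1" and b = "u $ 2" and c = "height_i u"] n R(2)
        unfolding x[OF u] by linarith+
      show "u $ 1 \<le> R" "u $ 2 \<le> R"
        by fact+
      have "ln (u $ 2 / u $ 1) \<le> u $ 2 / u $ 1 - 1"
        using pos by (intro ln_le_minus_one) simp
      then have "u $ 1 * (ln (u $ 2) - ln (u $ 1)) \<le> u $ 1 * (u $ 2 / u $ 1 - 1)"
        using pos by (intro mult_left_mono) (auto simp: ln_div)
      also have "\<dots> = u $ 2 - u $ 1"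
        using pos by (simp add: field_simps)
      finally have "u $ 1 * (ln (u $ 1) - ln (u $ 2)) \<ge> - R"
        using le(2) pos by (simp add: algebra_simps)
      then have inv: "1 / u $ 1 \<le> 2 * R"
        using le(3) unfolding height_i_def by linarith
      then show u1: "1 / (2 * R) \<le> u $ 1"
        using pos R by (simp add: field_simps)
      have "0 < 1 / u $ 1"
        using pos by simp
      then have "u $ 1 * (ln (u $ 1) - ln (u $ 2)) \<le> R"
        using le(3) unfolding height_i_def by linarith
      then have "ln (u $ 1) - ln (u $ 2) \<le> R * (1 / u $ 1)"
        using pos by (simp add: field_simps)
      also have "\<dots> \<le> R * (2 * R)"
        using inv R by (intro mult_left_mono) auto
      finally have "ln (u $ 1) - 2 * R\<^sup>2 \<le> ln (u $ 2)"
        by (simp add: power2_eq_square)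
      moreover have "ln (1 / (2 * R)) \<le> ln (u $ 1)"
        using u1 pos R by (subst ln_le_cancel_iff) auto
      ultimately have "- ln (2 * R) - 2 * R\<^sup>2 \<le> ln (u $ 2)"
        using R by (simp add: ln_div)
      then show "b \<le> u $ 2"
        using pos unfolding b_def by (metis exp_le_cancel_iff exp_ln)
    qed
    ultimately show "\<exists>K. compact K \<and> K \<subseteq> quadrant \<and> {u \<in> quadrant. norm (x u) \<le> R0} \<subseteq> K"
      by (intro exI[of _ ?K] conjI compact_rectangle)
  qed
qed


section \<open>The surfaces of type (ii)\<close>

definition halfplane :: "(real^2) set" where
  "halfplane = {u. 0 < u $ 2}"

text \<open>For c = (1 - \<alpha>) / (1 + \<alpha>) the exponent (1 + c) / 2 is 1 / (1 + \<alpha>):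
  this is the equation of the surface solved for the third coordinate. The same \<open>c\<close> is
  the constant \<open>k\<close> of the metric.\<close>

definition height_ii :: "real \<Rightarrow> real^2 \<Rightarrow> real" where
  "height_ii c u = ((u $ 1)\<^sup>2 + 1) powr ((1 + c) / 2) * u $ 2 powr (- c)"

lemma surface_ii_height_iff:
  fixes \<alpha> a b z :: real
  assumes "0 < \<alpha>" "\<alpha> < 1" "b > 0"
  shows "z > 0 \<and> b powr (1 - \<alpha>) * z powr (1 + \<alpha>) - a\<^sup>2 = 1 \<longleftrightarrow>
    z = (a\<^sup>2 + 1) powr ((1 + (1 - \<alpha>) / (1 + \<alpha>)) / 2) * b powr (- ((1 - \<alpha>) / (1 + \<alpha>)))"
proof -
  have w: "a\<^sup>2 + 1 > 0"
    by (simp add: add_nonneg_pos)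
  have e: "(1 + (1 - \<alpha>) / (1 + \<alpha>)) / 2 * (1 + \<alpha>) = 1" "- ((1 - \<alpha>) / (1 + \<alpha>)) * (1 + \<alpha>) = - (1 - \<alpha>)"
    using assms by (simp_all add: field_simps)
  define y where "y = (a\<^sup>2 + 1) powr ((1 + (1 - \<alpha>) / (1 + \<alpha>)) / 2) * b powr (- ((1 - \<alpha>) / (1 + \<alpha>)))"
  have y: "y > 0"
    using w assms by (simp add: y_def)
  have "y powr (1 + \<alpha>) = (a\<^sup>2 + 1) * b powr (- (1 - \<alpha>))"
    unfolding y_def using w assms
    by (subst powr_mult) (simp only: powr_powr e powr_one less_imp_le)
  then have yp: "b powr (1 - \<alpha>) * y powr (1 + \<alpha>) = a\<^sup>2 + 1"
    using assms(3) by (simp add: mult_ac flip: powr_add)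
  have "z > 0 \<and> b powr (1 - \<alpha>) * z powr (1 + \<alpha>) - a\<^sup>2 = 1 \<longleftrightarrow> z = y"
  proof
    assume z: "z > 0 \<and> b powr (1 - \<alpha>) * z powr (1 + \<alpha>) - a\<^sup>2 = 1"
    then have "b powr (1 - \<alpha>) * z powr (1 + \<alpha>) = b powr (1 - \<alpha>) * y powr (1 + \<alpha>)"
      using yp by simp
    then have "z powr (1 + \<alpha>) = y powr (1 + \<alpha>)"
      using assms by simp
    then show "z = y"
      using z y assms powr_inj[of z y] by (metis add_pos_pos less_imp_le powr_less_mono2 linorder_neqE_linordered_idom less_irrefl zero_less_one)
  next
    assume "z = y"
    then show "z > 0 \<and> b powr (1 - \<alpha>) * z powr (1 + \<alpha>) - a\<^sup>2 = 1"
      using yp y by simp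
  qed
  then show ?thesis
    by (simp only: y_def)
qed

lemma surface_ii_eq:
  assumes "0 < \<alpha>" "\<alpha> < 1"
  shows "surface_ii \<alpha> = (\<lambda>u. vector [u $ 1, u $ 2, height_ii ((1 - \<alpha>) / (1 + \<alpha>)) u]) ` halfplane"
proof (intro set_eqI iffI)
  let ?c = "(1 - \<alpha>) / (1 + \<alpha>)"
  note iff = surface_ii_height_iff[OF assms]
  fix q :: "real^3"
  show "q \<in> (\<lambda>u. vector [u $ 1, u $ 2, height_ii ?c u]) ` halfplane" if q: "q \<in> surface_ii \<alpha>"
  proof (rule image_eqI)
    show "vector [q $ 1, q $ 2] \<in> halfplane"
      using q by (simp add: surface_ii_def halfplane_def)
    have "q $ 3 = height_ii ?c (vector [q $ 1, q $ 2])"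
      using q iff[of "q $ 2" "q $ 3" "q $ 1"] by (simp add: surface_ii_def height_ii_def)
    then show "q = vector [(vector [q $ 1, q $ 2] :: real^2) $ 1, (vector [q $ 1, q $ 2] :: real^2) $ 2,
        height_ii ?c (vector [q $ 1, q $ 2])]"
      by (simp add: vec_eq_iff forall_3)
  qed
  show "q \<in> surface_ii \<alpha>" if q: "q \<in> (\<lambda>u. vector [u $ 1, u $ 2, height_ii ?c u]) ` halfplane"
  proof -
    obtain u where u: "u \<in> halfplane" "q = vector [u $ 1, u $ 2, height_ii ?c u]"
      using q by (elim imageE)
    then show ?thesis
      using iff[of "u $ 2" "height_ii ?c u" "u $ 1"]
      by (simp add: surface_ii_def halfplane_def height_ii_def[symmetric])
  qed
qed

text \<open>Every partial derivative of the height is the height times a rational function. With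
  \<open>height_ii c u\<close> kept as an opaque factor, all conditions on the Hessian become
  rational identities.\<close>

lemma hyperbolic_graph_ii:
  assumes x: "\<And>u. u \<in> halfplane \<Longrightarrow> x u = vector [u $ 1, u $ 2, height_ii c u]" and c: "0 < c" "c < 1"
  shows "hyperbolic_graph halfplane x (height_ii c)
    (\<lambda>u. (1 + c) * u $ 1 / ((u $ 1)\<^sup>2 + 1) * height_ii c u) (\<lambda>u. - c / u $ 2 * height_ii c u)
    (\<lambda>u. (1 + c) / ((u $ 1)\<^sup>2 + 1) * height_ii c u) c 1"
proof unfold_locales
  have w: "(u $ 1)\<^sup>2 + 1 > 0" for u :: "real^2"
    by (simp add: add_nonneg_pos)
  show "open halfplane"
    unfolding halfplane_def by (rule open_halfplane)
  show "connected halfplane"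
    unfolding halfplane_def by (intro convex_connected convex_halfplane)
  have "vector [1, 1] \<in> halfplane"
    by (simp add: halfplane_def)
  then show "halfplane \<noteq> {}"
    by blast
  show "smooth_on (height_ii c) halfplane"
    unfolding smooth_on_def
  proof
    fix k
    have "Ck_on k (\<lambda>u. (u $ 1 * u $ 1 + 1) powr ((1 + c) / 2) * u $ 2 powr (- c)) halfplane"
      by (intro Ck_on_add Ck_on_mult Ck_on_powr Ck_on_const Ck_on_vec_nth \<open>open halfplane\<close>)
        (auto simp: halfplane_def add_nonneg_pos)
    moreover have "height_ii c = (\<lambda>u. (u $ 1 * u $ 1 + 1) powr ((1 + c) / 2) * u $ 2 powr (- c))"
      by (simp add: height_ii_def fun_eq_iff power2_eq_square)
    ultimately show "Ck_on k (height_ii c) halfplane"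
      by simp
  qed
  fix u assume "u \<in> halfplane"
  then have b: "u $ 2 > 0"
    by (auto simp: halfplane_def)
  have f_pos: "height_ii c u > 0"
    unfolding height_ii_def by (intro mult_pos_pos) (use w[of u] b in auto)
  note nz = w[of u, THEN less_imp_neq, symmetric]
  have "has_partials (\<lambda>u. ((u $ 1)\<^sup>2 + 1) powr ((1 + c) / 2))
      ((1 + c) * u $ 1 / ((u $ 1)\<^sup>2 + 1) * ((u $ 1)\<^sup>2 + 1) powr ((1 + c) / 2)) 0 u"
    using w[of u] nz by (auto intro!: derivative_eq_intros simp: fun_eq_iff field_simps)
  moreover have "has_partials (\<lambda>u. u $ 2 powr (- c)) 0 (- c / u $ 2 * u $ 2 powr (- c)) u"
    using b by (auto intro!: derivative_eq_intros simp: fun_eq_iff field_simps)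
  ultimately show f: "has_partials (height_ii c) ((1 + c) * u $ 1 / ((u $ 1)\<^sup>2 + 1) * height_ii c u)
      (- c / u $ 2 * height_ii c u) u"
    unfolding height_ii_def by (rule has_derivative_eq_rhs[OF has_derivative_mult])
      (simp add: fun_eq_iff algebra_simps)
  have "has_partials (\<lambda>u. (1 + c) * u $ 1 / ((u $ 1)\<^sup>2 + 1))
      ((1 + c) * (1 - (u $ 1)\<^sup>2) / ((u $ 1)\<^sup>2 + 1)\<^sup>2) 0 u"
    using nz by (auto intro!: derivative_eq_intros)
      (simp add: fun_eq_iff divide_simps, simp add: algebra_simps power2_eq_square power4_eq_xxxx)
  from has_derivative_mult[OF this f]
  show "has_partials (\<lambda>u. (1 + c) * u $ 1 / ((u $ 1)\<^sup>2 + 1) * height_ii c u)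
      ((1 + c) / ((u $ 1)\<^sup>2 + 1) * height_ii c u * ((1 + c * (u $ 1)\<^sup>2) / ((u $ 1)\<^sup>2 + 1)))
      ((1 + c) / ((u $ 1)\<^sup>2 + 1) * height_ii c u * (- c * u $ 1 / u $ 2)) u"
    by (rule has_derivative_eq_rhs) (use nz b in \<open>simp add: fun_eq_iff divide_simps,
      simp add: algebra_simps power2_eq_square power4_eq_xxxx\<close>)
  have "has_partials (\<lambda>u. - c / u $ 2) 0 (c / (u $ 2)\<^sup>2) u"
    using b by (auto intro!: derivative_eq_intros) (simp add: fun_eq_iff divide_simps power2_eq_square)
  from has_derivative_mult[OF this f]
  show "has_partials (\<lambda>u. - c / u $ 2 * height_ii c u)
      ((1 + c) / ((u $ 1)\<^sup>2 + 1) * height_ii c u * (- c * u $ 1 / u $ 2))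
      ((1 + c) / ((u $ 1)\<^sup>2 + 1) * height_ii c u * (c * ((u $ 1)\<^sup>2 + 1) / (u $ 2)\<^sup>2)) u"
    by (rule has_derivative_eq_rhs) (use nz b in \<open>simp add: fun_eq_iff divide_simps,
      simp add: algebra_simps power2_eq_square power4_eq_xxxx\<close>)
  show "(1 + c) / ((u $ 1)\<^sup>2 + 1) * height_ii c u = height_ii c u
      - u $ 1 * ((1 + c) * u $ 1 / ((u $ 1)\<^sup>2 + 1) * height_ii c u) - u $ 2 * (- c / u $ 2 * height_ii c u)"
    using nz b by (simp add: divide_simps) (simp add: algebra_simps power2_eq_square)
  show "0 < (1 + c) / ((u $ 1)\<^sup>2 + 1) * height_ii c u"
    using w c f_pos by simp
  show "0 < (1 + c * (u $ 1)\<^sup>2) / ((u $ 1)\<^sup>2 + 1)"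
    using w c by (simp add: add_pos_nonneg)
  have "(1 + c * (u $ 1)\<^sup>2) / ((u $ 1)\<^sup>2 + 1) * (c * ((u $ 1)\<^sup>2 + 1) / (u $ 2)\<^sup>2) - (- c * u $ 1 / u $ 2)\<^sup>2
      = c / (u $ 2)\<^sup>2"
    using nz b by (simp add: divide_simps) (simp add: algebra_simps power2_eq_square)
  then show "0 < (1 + c * (u $ 1)\<^sup>2) / ((u $ 1)\<^sup>2 + 1) * (c * ((u $ 1)\<^sup>2 + 1) / (u $ 2)\<^sup>2)
      - (- c * u $ 1 / u $ 2)\<^sup>2"
    using b c by simp
  show "0 < (u $ 1)\<^sup>2 + 1"
    by (rule w)
qed (use x c in \<open>auto simp: halfplane_def\<close>)

text \<open>With u_1 = sinh s, the map is (ln cosh s, sqrt c \<tau>). The first entry has derivative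
  tanh s, bounded by 1, and the warping factor cosh^2 s \<ge> 1 in front of d\<tau>^2 may be
  dropped.\<close>

lemma centroaffine_complete_ii:
  assumes x: "\<And>u. u \<in> halfplane \<Longrightarrow> x u = vector [u $ 1, u $ 2, height_ii c u]" and c: "0 < c" "c < 1"
  shows "centroaffine_complete halfplane x"
proof -
  interpret hyperbolic_graph halfplane x "height_ii c" "\<lambda>u. (1 + c) * u $ 1 / ((u $ 1)\<^sup>2 + 1) * height_ii c u"
      "\<lambda>u. - c / u $ 2 * height_ii c u" "\<lambda>u. (1 + c) / ((u $ 1)\<^sup>2 + 1) * height_ii c u" c 1
    using hyperbolic_graph_ii[OF x c] .
  interpret R: riemannian_domain halfplane g
    by (rule riemannian_domain)
  define \<Phi> where "\<Phi> u = (ln ((u $ 1)\<^sup>2 + 1) / 2, sqrt c * (ln (u $ 2) - ln ((u $ 1)\<^sup>2 + 1) / 2))" for u :: "real^2"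
  define \<Phi>' where "\<Phi>' u v = (u $ 1 * v $ 1 / ((u $ 1)\<^sup>2 + 1),
      sqrt c * (v $ 2 / u $ 2 - u $ 1 * v $ 1 / ((u $ 1)\<^sup>2 + 1)))" for u v :: "real^2"
  have w: "(u $ 1)\<^sup>2 + 1 \<ge> 1" "(u $ 1)\<^sup>2 + 1 > 0" "(u $ 1)\<^sup>2 + 1 \<noteq> 0" for u :: "real^2"
    using zero_le_power2[of "u $ 1"] by linarith+
  have "complete_metric halfplane g"
  proof (rule R.complete_if_proper_Lipschitz_map[where \<Phi> = \<Phi> and \<Phi>' = \<Phi>' and C = 1])
    fix u :: "real^2" assume u: "u \<in> halfplane"
    then have b: "u $ 2 > 0"
      by (simp add: halfplane_def)
    have ln_w: "((\<lambda>u. ln ((u $ 1)\<^sup>2 + 1) / 2) has_derivative (\<lambda>v. u $ 1 * v $ 1 / ((u $ 1)\<^sup>2 + 1))) (at u)"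
    proof -
      have "((\<lambda>u. (u $ 1)\<^sup>2 + 1) has_derivative (\<lambda>v. 2 * (u $ 1 * v $ 1))) (at u)"
        by (auto intro!: derivative_eq_intros)
      from has_derivative_mult_right[OF has_derivative_ln[OF w(2) this], of "1 / 2"]
      show ?thesis
        by (simp add: inverse_eq_divide)
    qed
    have ln_b: "((\<lambda>u. ln (u $ 2)) has_derivative (\<lambda>v. v $ 2 / u $ 2)) (at u)"
      using b by (auto intro!: derivative_eq_intros simp: fun_eq_iff divide_inverse)
    show "(\<Phi> has_derivative \<Phi>' u) (at u)"
      unfolding \<Phi>_def \<Phi>'_def
      by (intro has_derivative_Pair has_derivative_mult_right has_derivative_diff ln_b ln_w)
    fix v :: "real^2"
    define s where "s = (v $ 1)\<^sup>2 / ((u $ 1)\<^sup>2 + 1)"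
    have "(u $ 1 * v $ 1 / ((u $ 1)\<^sup>2 + 1))\<^sup>2 = s * ((u $ 1)\<^sup>2 / ((u $ 1)\<^sup>2 + 1))"
      by (simp add: s_def power_divide power_mult_distrib power2_eq_square)
    also have "\<dots> \<le> s * 1"
      using w[of u] by (intro mult_left_mono) (auto simp: s_def)
    finally have "(u $ 1 * v $ 1 / ((u $ 1)\<^sup>2 + 1))\<^sup>2 \<le> s"
      by simp
    moreover have "c * (v $ 2 / u $ 2 - u $ 1 * v $ 1 / ((u $ 1)\<^sup>2 + 1))\<^sup>2
        \<le> c * ((u $ 1)\<^sup>2 + 1) * (v $ 2 / u $ 2 - u $ 1 * v $ 1 / ((u $ 1)\<^sup>2 + 1))\<^sup>2"
      using w[of u] c by (intro mult_right_mono) auto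
    moreover have "(norm A)\<^sup>2 + (norm (sqrt c * B))\<^sup>2 = A\<^sup>2 + c * B\<^sup>2" for A B :: real
      using c by (simp only: real_norm_def power2_abs power_mult_distrib) simp
    ultimately show "norm (\<Phi>' u v) \<le> 1 * sqrt (v \<bullet> (g u *v v))"
      unfolding quadratic_form_metric[OF u] \<Phi>'_def norm_Pair s_def mult_1
      by (intro real_sqrt_le_mono) (simp only: add_mono)
  next
    fix R :: real
    \<comment> \<open>Since ln u_2 = \<tau> + (ln w) / 2, its bound is the sum of R / sqrt c for
      \<tau> and R for the other term.\<close>
    define S where "S = R + R / sqrt c"
    let ?K = "{u :: real^2. - exp R \<le> u $ 1 \<and> u $ 1 \<le> exp R \<and> exp (- S) \<le> u $ 2 \<and> u $ 2 \<le> exp S}"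
    have "?K \<subseteq> halfplane"
      unfolding halfplane_def by (auto intro: less_le_trans[of 0 "exp (- S)"])
    moreover have "{u \<in> halfplane. norm (\<Phi> u) \<le> R} \<subseteq> ?K"
    proof
      fix u assume "u \<in> {u \<in> halfplane. norm (\<Phi> u) \<le> R}"
      then have b: "u $ 2 > 0" and n: "norm (\<Phi> u) \<le> R"
        by (auto simp: halfplane_def)
      have 1: "\<bar>ln ((u $ 1)\<^sup>2 + 1) / 2\<bar> \<le> R"
        using norm_fst_le[of "fst (\<Phi> u)" "snd (\<Phi> u)"] n by (simp add: \<Phi>_def)
      have "\<bar>sqrt c * (ln (u $ 2) - ln ((u $ 1)\<^sup>2 + 1) / 2)\<bar> \<le> R"
        using norm_snd_le[of "snd (\<Phi> u)" "fst (\<Phi> u)"] n by (simp add: \<Phi>_def)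
      then have 2: "\<bar>ln (u $ 2) - ln ((u $ 1)\<^sup>2 + 1) / 2\<bar> \<le> R / sqrt c"
        unfolding abs_mult using c by (simp add: pos_le_divide_eq mult.commute)
      have "ln ((u $ 1)\<^sup>2 + 1) \<le> 2 * R"
        using 1 by simp
      then have "(u $ 1)\<^sup>2 + 1 \<le> exp (2 * R)"
        using w(2)[of u] by (metis exp_le_cancel_iff exp_ln)
      then have "(u $ 1)\<^sup>2 \<le> (exp R)\<^sup>2"
        by (simp add: exp_double)
      then have "\<bar>u $ 1\<bar> \<le> exp R"
        by (metis abs_exp_cancel abs_le_square_iff)
      moreover have "\<bar>ln (u $ 2)\<bar> \<le> S"
        using 1 2 unfolding S_def by linarith
      then have "exp (- S) \<le> exp (ln (u $ 2))" "exp (ln (u $ 2)) \<le> exp S"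
        by auto
      ultimately show "u \<in> ?K"
        using b by auto
    qed
    ultimately show "\<exists>K. compact K \<and> K \<subseteq> halfplane \<and> {u \<in> halfplane. norm (\<Phi> u) \<le> R} \<subseteq> K"
      by (intro exI[of _ ?K] conjI compact_rectangle)
  qed simp
  then show ?thesis
    by (simp add: centroaffine_complete_def)
qed

lemma euclidean_complete_ii:
  assumes x: "\<And>u. u \<in> halfplane \<Longrightarrow> x u = vector [u $ 1, u $ 2, height_ii c u]" and c: "0 < c" "c < 1"
  shows "euclidean_complete halfplane x"
proof -
  interpret hyperbolic_graph halfplane x "height_ii c" "\<lambda>u. (1 + c) * u $ 1 / ((u $ 1)\<^sup>2 + 1) * height_ii c u"
      "\<lambda>u. - c / u $ 2 * height_ii c u" "\<lambda>u. (1 + c) / ((u $ 1)\<^sup>2 + 1) * height_ii c u" c 1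
    using hyperbolic_graph_ii[OF x c] .
  show ?thesis
  proof (rule euclidean_complete_if_proper[OF centroaffine_surface])
    fix R0 :: real
    define R where "R = max R0 1"
    \<comment> \<open>The first factor of the height is at least 1, so a height of at most
      \<open>R\<close> forces u_2 powr (- c) \<le> R.\<close>
    define b where "b = R powr (- 1 / c)"
    let ?K = "{u :: real^2. - R \<le> u $ 1 \<and> u $ 1 \<le> R \<and> b \<le> u $ 2 \<and> u $ 2 \<le> R}"
    have R: "R \<ge> 1" "R0 \<le> R" and b: "b > 0"
      by (auto simp: R_def b_def)
    have "?K \<subseteq> halfplane"
      unfolding halfplane_def using b by auto
    moreover have "{u \<in> halfplane. norm (x u) \<le> R0} \<subseteq> ?K"
    proof
      fix u assume "u \<in> {u \<in> halfplane. norm (x u) \<le> R0}"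
      then have u: "u \<in> halfplane" and n: "norm (x u) \<le> R0"
        by auto
      have pos: "u $ 2 > 0"
        using u by (simp add: halfplane_def)
      have le: "\<bar>u $ 1\<bar> \<le> R" "u $ 2 \<le> R" "height_ii c u \<le> R"
        using component_le_norm_vector_3[where a = "u $ 1" and b = "u $ 2" and c = "height_ii c u"] n R(2)
        unfolding x[OF u] by linarith+
      have "1 * u $ 2 powr (- c) \<le> height_ii c u"
        unfolding height_ii_def using c by (intro mult_right_mono ge_one_powr_ge_zero) auto
      then have "u $ 2 powr (- c) \<le> R"
        using le(3) by simp
      then have "R powr (- 1 / c) \<le> (u $ 2 powr (- c)) powr (- 1 / c)"
        using c pos by (intro powr_mono2') auto
      then have "b \<le> u $ 2"
        using c pos by (simp add: powr_powr b_def)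
      then show "u \<in> ?K"
        using le by auto
    qed
    ultimately show "\<exists>K. compact K \<and> K \<subseteq> halfplane \<and> {u \<in> halfplane. norm (x u) \<le> R0} \<subseteq> K"
      by (intro exI[of _ ?K] conjI compact_rectangle)
  qed
qed


section \<open>Graphs over the plane\<close>

text \<open>The ray is open because the function of type (i) tends to minus infinity at its end
  point; explicit points with values on both sides of \<open>y\<close> replace the limits.\<close>

lemma ex1_strict_mono_continuous:
  fixes G :: "real \<Rightarrow> real"
  assumes "continuous_on {m<..} G"
    and mono: "\<And>s t. \<lbrakk>m < s; s < t\<rbrakk> \<Longrightarrow> G s < G t"
    and "m < s0" "G s0 \<le> y" "m < t0" "y \<le> G t0"
  shows "\<exists>!t. m < t \<and> G t = y"
proof -
  have "s0 \<le> t0"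
    using mono[of t0 s0] assms by (metis leI le_less_trans less_irrefl less_le_trans)
  moreover have "continuous_on {s0..t0} G"
    using assms by (auto intro: continuous_on_subset)
  ultimately obtain t where t: "s0 \<le> t" "G t = y"
    using IVT'[of G s0 y t0] assms by blast
  moreover have "s = t" if "m < s" "G s = y" for s
    using mono[of s t] mono[of t s] that t assms by (cases s t rule: linorder_cases) auto
  ultimately show ?thesis
    using assms by (intro ex1I[of _ t]) auto
qed

text \<open>Both projections are along a direction interior to the recession cone of the convex hull, so
  every line in that direction meets the surface once.\<close>

lemma surface_i_line:
  "\<exists>!t. vector [t, t - y1, t - y2] \<in> surface_i"
proof -
  define m where "m = max 0 y1"
  \<comment> \<open>The surface equation on the line, with third coordinate t - y2, solved for
    y2.\<close>
  define G where "G t = t - 1 / t - t * (ln t - ln (t - y1))" for t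
  have m: "t > 0 \<and> t - y1 > 0 \<longleftrightarrow> m < t" for t
    by (auto simp: m_def)
  have deriv: "(G has_real_derivative 1 / t\<^sup>2 + t / (t - y1) - ln t + ln (t - y1)) (at t)" if "m < t" for t
    unfolding G_def using that m[of t]
    by (auto intro!: derivative_eq_intros simp: field_simps power2_eq_square)
  \<comment> \<open>For z = t / (t - y1) the derivative is 1 / t^2 + z - ln z, and ln z \<le> z -
    1.\<close>
  have deriv_pos: "0 < 1 / t\<^sup>2 + t / (t - y1) - ln t + ln (t - y1)" if "m < t" for t
  proof -
    have pos: "t > 0" "t - y1 > 0"
      using m that by auto
    have "ln (t / (t - y1)) \<le> t / (t - y1) - 1"
      using pos by (intro ln_le_minus_one) simp
    moreover have "ln (t / (t - y1)) = ln t - ln (t - y1)"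
      using pos by (simp add: ln_div)
    moreover have "0 < 1 / t\<^sup>2"
      using pos by simp
    ultimately show ?thesis
      by linarith
  qed
  have mono: "G s < G t" if "m < s" "s < t" for s t
  proof (rule DERIV_pos_imp_increasing[OF that(2)])
    fix r assume "s \<le> r" "r \<le> t"
    then have "m < r"
      using that by simp
    then show "\<exists>y. (G has_real_derivative y) (at r) \<and> 0 < y"
      using deriv deriv_pos by blast
  qed
  have cont: "continuous_on {m<..} G"
    using deriv by (intro continuous_at_imp_continuous_on ballI DERIV_isCont) auto
  have upper: "\<exists>t>m. y2 \<le> G t"
  proof -
    \<comment> \<open>The summand 4 |y1| gives t \<le> 2 (t - y1), so the logarithmic term is at
      most 2 |y1|; the rest of \<open>t\<close> absorbs this, 1 / t and y2.\<close>
    define t where "t = 2 + 4 * \<bar>y1\<bar> + \<bar>y2\<bar>"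
    have t: "t > 0" "m < t" "t - y1 > 0" "t \<le> 2 * (t - y1)"
      unfolding t_def m_def by (auto simp: abs_if)
    have "ln (t / (t - y1)) \<le> t / (t - y1) - 1"
      using t by (intro ln_le_minus_one) simp
    then have "t * (ln t - ln (t - y1)) \<le> t * (t / (t - y1) - 1)"
      using t by (intro mult_left_mono) (auto simp: ln_div)
    also have "\<dots> = t / (t - y1) * y1"
      using t by (simp add: field_simps)
    also have "\<dots> \<le> t / (t - y1) * \<bar>y1\<bar>"
      using t by (intro mult_left_mono) auto
    also have "\<dots> \<le> 2 * \<bar>y1\<bar>"
      using t by (intro mult_right_mono) (auto simp: divide_le_eq)
    finally have "t * (ln t - ln (t - y1)) \<le> 2 * \<bar>y1\<bar>" .
    moreover have "1 / t \<le> 1"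
      by (simp add: t_def)
    ultimately have "y2 \<le> G t"
      unfolding G_def t_def by linarith
    then show ?thesis
      using t by blast
  qed
  have lower: "\<exists>s>m. G s \<le> y2"
  proof (cases "y1 > 0")
    case True
    \<comment> \<open>Here the ray starts at y1, and ln (t - y1) drives \<open>G\<close> down. The
      point \<open>s\<close> is chosen so that ln s - ln (s - y1) = N exactly; then G s \<le> y1 (1
      - N) = - |y2|.\<close>
    define N where "N = 1 + \<bar>y2\<bar> / y1"
    define s where "s = y1 / (1 - exp (- N))"
    have N: "N \<ge> 1"
      using True by (simp add: N_def)
    then have e: "exp (- N) < 1"
      by simp
    have s: "s \<ge> y1" "s > 0" and sy: "s - y1 = s * exp (- N)"
      using True e by (auto simp: s_def field_simps)
    have "s - y1 > 0"
      using s by (simp add: sy)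
    then have "m < s"
      using m s by blast
    have "ln (s - y1) = ln s - N"
      using s by (simp add: sy ln_mult)
    then have "G s = s - 1 / s - s * N"
      by (simp add: G_def)
    also have "\<dots> \<le> s * (1 - N)"
      using s by (simp add: algebra_simps)
    also have "\<dots> \<le> y1 * (1 - N)"
      using s N by (intro mult_right_mono_neg) auto
    also have "\<dots> = - \<bar>y2\<bar>"
      using True by (simp add: N_def)
    finally have "G s \<le> y2"
      by linarith
    then show ?thesis
      using \<open>m < s\<close> by blast
  next
    case False
    \<comment> \<open>Here the ray starts at 0, and - 1 / t drives \<open>G\<close> down. The
      logarithmic term adds at most |y1|, which the value of 1 / s outweighs together with |y2| and
      s \<le> 1.\<close>
    define s where "s = 1 / (3 + \<bar>y1\<bar> + \<bar>y2\<bar>)"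
    have s: "0 < s" "s \<le> 1" "1 / s = 3 + \<bar>y1\<bar> + \<bar>y2\<bar>"
      by (auto simp: s_def)
    have sy: "s - y1 > 0" "m < s"
      using s False by (auto simp: m_def)
    have "ln ((s - y1) / s) \<le> (s - y1) / s - 1"
      using s sy by (intro ln_le_minus_one) simp
    then have "s * (ln (s - y1) - ln s) \<le> s * ((s - y1) / s - 1)"
      using s sy by (intro mult_left_mono) (auto simp: ln_div)
    also have "\<dots> = \<bar>y1\<bar>"
      using s False by (simp add: field_simps)
    finally have "G s \<le> s - 1 / s + \<bar>y1\<bar>"
      unfolding G_def by (simp add: algebra_simps)
    then have "G s \<le> y2"
      using s by linarith
    then show ?thesis
      using sy by blast
  qed
  obtain s0 t0 where st: "m < s0" "G s0 \<le> y2" "m < t0" "y2 \<le> G t0"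
    using lower upper by blast
  have "\<exists>!t. m < t \<and> G t = y2"
    by (rule ex1_strict_mono_continuous[OF cont _ st]) (rule mono)
  moreover have "vector [t, t - y1, t - y2] \<in> surface_i \<longleftrightarrow> m < t \<and> G t = y2" for t
    unfolding m[symmetric] by (auto simp: surface_i_def G_def)
  ultimately show ?thesis
    by simp
qed

lemma surface_ii_line:
  assumes \<alpha>: "0 < \<alpha>" "\<alpha> < 1"
  shows "\<exists>!t. vector [y1, t, t - y2] \<in> surface_ii \<alpha>"
proof -
  define m where "m = max 0 y2"
  define y where "y = 1 + y1\<^sup>2"
  define G where "G t = t powr (1 - \<alpha>) * (t - y2) powr (1 + \<alpha>)" for t
  have m: "t > 0 \<and> t - y2 > 0 \<longleftrightarrow> m < t" for t
    by (auto simp: m_def)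
  have y: "y \<ge> 1"
    by (simp add: y_def)
  have mono: "G s < G t" if "m \<le> s" "s < t" for s t
    unfolding G_def using that \<alpha> by (intro mult_strict_mono' powr_less_mono2) (auto simp: m_def)
  have cont: "continuous_on {m..} G"
    unfolding G_def using \<alpha>
    by (intro continuous_on_mult continuous_on_powr' continuous_intros) (auto simp: m_def)
  \<comment> \<open>One of the two bases is 0 at \<open>m\<close>, and a power of 0 is 0 under
    \<open>powr\<close>. The end point thus supplies the lower value for the intermediate value
    theorem.\<close>
  have "G m = 0"
    by (auto simp: G_def m_def max_def)
  \<comment> \<open>Both bases are at least \<open>y\<close> at \<open>T\<close>, and the exponents
    add up to 2, so G T \<ge> y^2 \<ge> y.\<close>
  define T where "T = m + y"
  have T: "y \<le> T" "y \<le> T - y2" "m < T"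
    using y by (auto simp: T_def m_def)
  have "y \<le> y powr (1 - \<alpha>) * y powr (1 + \<alpha>)"
    using y by (simp add: power2_eq_square flip: powr_add)
  also have "\<dots> \<le> G T"
    unfolding G_def using T y \<alpha> by (intro mult_mono powr_mono2) auto
  finally have "y \<le> G T" .
  have "\<exists>t\<ge>m. t \<le> T \<and> G t = y"
    using \<open>G m = 0\<close> y T \<open>y \<le> G T\<close> by (intro IVT' continuous_on_subset[OF cont]) auto
  then obtain t where t: "m \<le> t" "G t = y"
    by blast
  then have "m \<noteq> t"
    using \<open>G m = 0\<close> y by auto
  have "\<exists>!t. m < t \<and> G t = y"
  proof (rule ex1I)
    show "m < t \<and> G t = y"
      using t \<open>m \<noteq> t\<close> by simp
    fix s assume "m < s \<and> G s = y"
    then show "s = t"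
      using mono[of s t] mono[of t s] t by (cases s t rule: linorder_cases) auto
  qed
  moreover have "vector [y1, t, t - y2] \<in> surface_ii \<alpha> \<longleftrightarrow> m < t \<and> G t = y" for t
    unfolding m[symmetric] by (auto simp: surface_ii_def G_def y_def)
  ultimately show ?thesis
    by simp
qed

section \<open>The linear transformations and the conclusion\<close>

lemma graph_over_plane_i:
  "\<exists>A :: real^3^3. invertible A \<and> graph_over_plane ((\<lambda>q. A *v q) ` surface_i)"
proof -
  \<comment> \<open>\<open>A\<close> sends x to (x_1 - x_2, x_1 - x_3, x_1): its first two rows
    annihilate the projection direction (1, 1, 1).\<close>
  define A :: "real^3^3" where "A = vector [vector [1, -1, 0], vector [1, 0, -1], vector [1, 0, 0]]"
  define B :: "real^3^3" where "B = vector [vector [0, 0, 1], vector [-1, 0, 1], vector [0, -1, 1]]"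
  have "A ** B = mat 1"
    by (simp add: A_def B_def vec_eq_iff forall_3 matrix_matrix_mult_def sum_3 mat_def)
  moreover have "B *v vector [y1, y2, t] = vector [t, t - y1, t - y2]" for y1 y2 t
    by (simp add: B_def vec_eq_iff forall_3 matrix_vector_mult_def sum_3)
  ultimately show ?thesis
    using graph_over_plane_image[of A B surface_i] surface_i_line by auto
qed

lemma graph_over_plane_ii:
  assumes "0 < \<alpha>" "\<alpha> < 1"
  shows "\<exists>A :: real^3^3. invertible A \<and> graph_over_plane ((\<lambda>q. A *v q) ` surface_ii \<alpha>)"
proof -
  \<comment> \<open>The projection direction is (0, 1, 1), annihilated by the first two entries of
    (x_1, x_2 - x_3, x_2).\<close>
  define A :: "real^3^3" where "A = vector [vector [1, 0, 0], vector [0, 1, -1], vector [0, 1, 0]]"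
  define B :: "real^3^3" where "B = vector [vector [1, 0, 0], vector [0, 0, 1], vector [0, -1, 1]]"
  have "A ** B = mat 1"
    by (simp add: A_def B_def vec_eq_iff forall_3 matrix_matrix_mult_def sum_3 mat_def)
  moreover have "B *v vector [y1, y2, t] = vector [y1, t, t - y2]" for y1 y2 t
    by (simp add: B_def vec_eq_iff forall_3 matrix_vector_mult_def sum_3)
  ultimately show ?thesis
    using graph_over_plane_image[of A B "surface_ii \<alpha>"] surface_ii_line[OF assms] by auto
qed

theorem theorem1p3:
  fixes M :: "(real^2) set" and x :: "real^2 \<Rightarrow> real^3"
  assumes "in_graph_coordinates surface_i M x \<or>
           (\<exists>\<alpha>. 0 < \<alpha> \<and> \<alpha> < 1 \<and> in_graph_coordinates (surface_ii \<alpha>) M x)"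
  shows "hyperbolic M x \<and> centroaffine_extremal M x \<and>
         (\<forall>u\<in>M. gauss_curvature (centroaffine_metric M x) u = -1) \<and>
         centroaffine_complete M x \<and> euclidean_complete M x \<and>
         (\<exists>A :: real^3^3. invertible A \<and> graph_over_plane ((\<lambda>p. A *v p) ` x ` M))"
  using assms
proof (elim disjE exE conjE)
  assume S: "in_graph_coordinates surface_i M x"
  note * = in_graph_coordinates_imp[OF S surface_i_eq]
  have x: "x u = vector [u $ 1, u $ 2, height_i u]" if "u \<in> quadrant" for u
    using * that by simp
  have image: "x ` M = surface_i"
    using S by (simp add: in_graph_coordinates_def)
  interpret hyperbolic_graph quadrant x height_i "\<lambda>u. 1 - 1 / (u $ 1)\<^sup>2 + ln (u $ 1) - ln (u $ 2)"
      "\<lambda>u. - u $ 1 / u $ 2" "\<lambda>u. 2 / u $ 1" "1 / 2" 0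
    using hyperbolic_graph_i[OF x] .
  show ?thesis
    \<comment> \<open>The image of \<open>x\<close> is replaced by the surface before
      \<open>M\<close> is rewritten, since \<open>image\<close> is stated for
      \<open>M\<close>.\<close>
    unfolding image unfolding *(1)
    using hyperbolic centroaffine_extremal gauss_curvature_metric centroaffine_complete_i[OF x]
      euclidean_complete_i[OF x] graph_over_plane_i by blast
next
  fix \<alpha> :: real
  assume \<alpha>: "0 < \<alpha>" "\<alpha> < 1" and S: "in_graph_coordinates (surface_ii \<alpha>) M x"
  define c where "c = (1 - \<alpha>) / (1 + \<alpha>)"
  have c: "0 < c" "c < 1"
    using \<alpha> by (simp_all add: c_def)
  note * = in_graph_coordinates_imp[OF S surface_ii_eq[OF \<alpha>, folded c_def]]
  have x: "x u = vector [u $ 1, u $ 2, height_ii c u]" if "u \<in> halfplane" for u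
    using * that by simp
  have image: "x ` M = surface_ii \<alpha>"
    using S by (simp add: in_graph_coordinates_def)
  interpret hyperbolic_graph halfplane x "height_ii c" "\<lambda>u. (1 + c) * u $ 1 / ((u $ 1)\<^sup>2 + 1) * height_ii c u"
      "\<lambda>u. - c / u $ 2 * height_ii c u" "\<lambda>u. (1 + c) / ((u $ 1)\<^sup>2 + 1) * height_ii c u" c 1
    using hyperbolic_graph_ii[OF x c] .
  show ?thesis
    unfolding image unfolding *(1)
    using hyperbolic centroaffine_extremal gauss_curvature_metric centroaffine_complete_ii[OF x c]
      euclidean_complete_ii[OF x c] graph_over_plane_ii[OF \<alpha>] by blast
qed

end
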